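(* Let $\mathbf M = \langle Q \cup \Sigma \cup \{0\}; \cdot\rangle$ be a finite automatic algebra with $|\Sigma| = 1$. Then $\mathbf M$ is dualizable if and only if its letter acts as whiskery cycles (equivalently, if and only if $\mathbf M$ satisfies the quasi-equation $vxx \approx wxx \implies vx \approx wx$).
   Context: **Automatic algebras.** An automatic algebra is an algebra with a single binary operation $\mathbf M = \langle Q \cup \Sigma \cup \{0\}; \cdot\rangle$, where $Q$ (states) and $\Sigma$ (letters) are disjoint sets and $0 \notin Q\cup\Sigma$, that encodes a partial (deterministic) automaton: each letter $a \in \Sigma$ acts as a partial map $Q \to Q$; for $q,r\in Q$ and $a \in \Sigma$ we have $q\cdot a = r$ iff $a$ sends $q$ to $r$; all other products are $0$. Products are bracketed from the left: $uv_1v_2\cdots v_n := (\cdots((u\cdot v_1)\cdot v_2)\cdots)\cdot v_n$, and $u\cdot v^n$ (or $uv^n$) means $uvv\cdots v$ with $n$ occurrences of $v$. $\mathbb N=\{1,2,3,\dots\}$. **Whiskery cycles.** A letter $a \in \Sigma$ acts as whiskery cycles if for all $q \in Q$ there exists $n \in \mathbb N$ such that $qa = qa^{n+1}$. **Dualizability.** Let $\mathbf M$ be a finite algebra with universe $M$. A $k$-ary relation on $M$ ($k\ge 1$) is compatible with $\mathbf M$ if it is a subuniverse of $\mathbf M^k$. For $\mathbf A \in \mathbb{ISP}(\mathbf M)$ (isomorphic copies of subalgebras of powers of $\mathbf M$), view $\hom(\mathbf A,\mathbf M)\subseteq M^A$ with the subspace topology of the product topology ($M$ discrete), and with relations on $M$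 interpreted pointwise. A map $f\colon \hom(\mathbf A,\mathbf M)\to M$ is an evaluation if there is $a\in A$ with $f(x)=x(a)$ for all $x$. The algebra $\mathbf M$ is dualizable if, for every $\mathbf A\in\mathbb{ISP}(\mathbf M)$, every continuous map $f\colon\hom(\mathbf A,\mathbf M)\to M$ that preserves all finitary compatible relations on $\mathbf M$ is an evaluation. *)

theory Defs
  imports "HOL-Analysis.Analysis"
begin

record 'a binary_algebra =
  univ :: "'a set"
  mult :: "'a \<Rightarrow> 'a \<Rightarrow> 'a" (infixl "\<cdot>\<index>" 70)

text \<open>Algebras have a nonempty universe; a subuniverse may be empty. The value of the operation
  outside the universe is irrelevant.\<close>

definition is_algebra :: "'a binary_algebra \<Rightarrow> bool" where
  "is_algebra A \<longleftrightarrow> univ A \<noteq> {} \<and> (\<forall>u\<in>univ A. \<forall>v\<in>univ A. u \<cdot>\<^bsub>A\<^esub> v \<in> univ A)"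

definition subuniverse :: "'a binary_algebra \<Rightarrow> 'a set \<Rightarrow> bool" where
  "subuniverse A S \<longleftrightarrow> S \<subseteq> univ A \<and> (\<forall>u\<in>S. \<forall>v\<in>S. u \<cdot>\<^bsub>A\<^esub> v \<in> S)"

definition homs :: "'a binary_algebra \<Rightarrow> 'b binary_algebra \<Rightarrow> ('a \<Rightarrow> 'b) set" where
  "homs A B = {h \<in> univ A \<rightarrow>\<^sub>E univ B.
     \<forall>u\<in>univ A. \<forall>v\<in>univ A. h (u \<cdot>\<^bsub>A\<^esub> v) = h u \<cdot>\<^bsub>B\<^esub> h v}"

definition isomorphic :: "'a binary_algebra \<Rightarrow> 'b binary_algebra \<Rightarrow> bool" where
  "isomorphic A B \<longleftrightarrow> (\<exists>h\<in>homs A B. bij_betw h (univ A) (univ B))"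

definition power_algebra :: "'a binary_algebra \<Rightarrow> 'i set \<Rightarrow> ('i \<Rightarrow> 'a) binary_algebra" where
  "power_algebra M I =
     \<lparr>univ = (I \<rightarrow>\<^sub>E univ M), mult = (\<lambda>x y. \<lambda>i\<in>I. x i \<cdot>\<^bsub>M\<^esub> y i)\<rparr>"

text \<open>Isomorphic copies, with universe in type \<open>'b\<close>, of subalgebras of powers of \<open>M\<close> with
  exponent in type \<open>'i\<close>.\<close>

definition ISP :: "'i itself \<Rightarrow> 'a binary_algebra \<Rightarrow> 'b binary_algebra set" where
  "ISP _ M = {A. is_algebra A \<and>
     (\<exists>(I :: 'i set) S. S \<noteq> {} \<and> subuniverse (power_algebra M I) S \<and>
        isomorphic A ((power_algebra M I)\<lparr>univ := S\<rparr>))}"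

definition compatible_relation :: "'a binary_algebra \<Rightarrow> nat \<Rightarrow> (nat \<Rightarrow> 'a) set \<Rightarrow> bool" where
  "compatible_relation M k R \<longleftrightarrow> k \<ge> 1 \<and> subuniverse (power_algebra M {..<k}) R"

definition hom_topology ::
  "'b binary_algebra \<Rightarrow> 'a binary_algebra \<Rightarrow> ('b \<Rightarrow> 'a) topology" where
  "hom_topology A M =
     subtopology (product_topology (\<lambda>_. discrete_topology (univ M)) (univ A)) (homs A M)"

definition preserves ::
  "'b binary_algebra \<Rightarrow> 'a binary_algebra \<Rightarrow> (('b \<Rightarrow> 'a) \<Rightarrow> 'a) \<Rightarrow> nat \<Rightarrow> (nat \<Rightarrow> 'a) set \<Rightarrow> bool"
  where
  "preserves A M f k R \<longleftrightarrow> (\<forall>x. (\<forall>i<k. x i \<in> homs A M) \<and>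
      (\<forall>a\<in>univ A. (\<lambda>i\<in>{..<k}. x i a) \<in> R) \<longrightarrow> (\<lambda>i\<in>{..<k}. f (x i)) \<in> R)"

definition evaluation ::
  "'b binary_algebra \<Rightarrow> 'a binary_algebra \<Rightarrow> (('b \<Rightarrow> 'a) \<Rightarrow> 'a) \<Rightarrow> bool" where
  "evaluation A M f \<longleftrightarrow> (\<exists>a\<in>univ A. \<forall>x\<in>homs A M. f x = x a)"

text \<open>A definition cannot quantify over types, so the types carrying the exponents and the
  members of ISP(M) are parameters. Dualizability in the usual sense is
  \<open>dualizable TYPE('i) TYPE('b) M\<close> for all types \<open>'i\<close> and \<open>'b\<close>. For finite \<open>M\<close>, a
  compactness argument shows that countable members of ISP(M) already decide dualizability, so
  any single choice of infinite \<open>'i\<close> and \<open>'b\<close> gives the same notion; finite types do not.\<close>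

definition dualizable :: "'i itself \<Rightarrow> 'b itself \<Rightarrow> 'a binary_algebra \<Rightarrow> bool" where
  "dualizable TI _ M \<longleftrightarrow> (\<forall>(A :: 'b binary_algebra) \<in> ISP TI M. \<forall>f.
     continuous_map (hom_topology A M) (discrete_topology (univ M)) f \<and>
     (\<forall>k R. compatible_relation M k R \<longrightarrow> preserves A M f k R) \<longrightarrow>
     evaluation A M f)"

text \<open>The letter \<open>a\<close> acts on the states as the partial map \<open>act a\<close>.\<close>

definition automatic_algebra ::
  "'a binary_algebra \<Rightarrow> 'a set \<Rightarrow> 'a set \<Rightarrow> 'a \<Rightarrow> ('a \<Rightarrow> 'a \<rightharpoonup> 'a) \<Rightarrow> bool" where
  "automatic_algebra M Q \<Sigma> z act \<longleftrightarrow>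
     univ M = Q \<union> \<Sigma> \<union> {z} \<and> Q \<inter> \<Sigma> = {} \<and> z \<notin> Q \<union> \<Sigma> \<and>
     (\<forall>a\<in>\<Sigma>. dom (act a) \<subseteq> Q \<and> ran (act a) \<subseteq> Q) \<and>
     (\<forall>q\<in>Q. \<forall>a\<in>\<Sigma>. \<forall>r\<in>Q. q \<cdot>\<^bsub>M\<^esub> a = r \<longleftrightarrow> act a q = Some r) \<and>
     (\<forall>u\<in>univ M. \<forall>v\<in>univ M.
        \<not> (u \<in> Q \<and> v \<in> \<Sigma> \<and> u \<in> dom (act v)) \<longrightarrow> u \<cdot>\<^bsub>M\<^esub> v = z)"

definition left_power :: "'a binary_algebra \<Rightarrow> 'a \<Rightarrow> 'a \<Rightarrow> nat \<Rightarrow> 'a" where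
  "left_power M u v n = ((\<lambda>w. w \<cdot>\<^bsub>M\<^esub> v) ^^ n) u"

definition whiskery_cycles :: "'a binary_algebra \<Rightarrow> 'a set \<Rightarrow> 'a \<Rightarrow> bool" where
  "whiskery_cycles M Q a \<longleftrightarrow> (\<forall>q\<in>Q. \<exists>n\<ge>1. q \<cdot>\<^bsub>M\<^esub> a = left_power M q a (n + 1))"

end

theory Submission
  imports Defs
begin

text \<open>
  Write \<open>l\<close> for the letter, \<open>z\<close> for the zero and \<open>\<alpha> u\<close> for \<open>u \<cdot> l\<close>. A product \<open>u \<cdot> v\<close> is \<open>\<alpha> u\<close> if
  \<open>v = l\<close>, and \<open>z\<close> otherwise, so \<open>\<alpha>\<close> determines the algebra. The letter acts as whiskery cycles
  if and only if \<open>\<alpha>\<close> permutes its image, and as \<open>M\<close> is finite this means that \<open>\<alpha>\<close> is injective on its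
  image, which is what the quasi-equation says.

  Dualizability is about maps \<open>f\<close> on homs that agree with some evaluation on every finite set of homs
  (\<open>preserves_all_iff_finitely_evaluated\<close>) and that near each hom depend on finitely many
  elements only (\<open>continuous_iff_finitely_supported\<close>).

  If \<open>r = \<alpha> q\<close> is not periodic under \<open>\<alpha>\<close>, there is a countable subalgebra of a power of \<open>M\<close> with a
  sequence \<open>d\<close> on which every hom is constant up to one exception. Sending a hom to its common value on \<open>d\<close> is
  such a map \<open>f\<close>, and the only possible evaluation is at the pointwise limit of the sequence.
  This limit has \<open>r\<close> at one coordinate and \<open>z\<close> elsewhere; if \<open>r\<close> were on a cycle, one could
  reach it by multiplying elements of the sequence with letters that erase the other coordinates and
  going round the cycle, but as it is, the limit is missing from the algebra
  (\<open>nondualizable_if_ghost\<close>, \<open>nondualizable_if_not_periodic\<close>).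

  If \<open>\<alpha>\<close> permutes its image, let \<open>f\<close> be as above. If \<open>f\<close> takes a value outside the image of
  \<open>\<alpha>\<close>, then \<open>f\<close> is an evaluation at one of the finitely many elements that support it, because
  homs can be changed freely enough at all other elements
  (\<open>evaluation_if_value_not_in_image\<close>). If all values are in the image of \<open>\<alpha>\<close>, then the homs on which
  \<open>f\<close> is not \<open>z\<close> are those whose support contains the support of some minimal hom. Its states are
  connected through multiplication by its letters, because otherwise it would split into two smaller homs
  and no evaluation could agree with \<open>f\<close> at all three. As \<open>\<alpha>\<close> is injective on its image,
  values propagate along the connections in both directions, so that one element, multiplied by
  finitely many letters, records the values of \<open>f\<close> at all homs
  (\<open>evaluation_if_values_in_image\<close>).
\<close>


section \<open>Evaluations on finite sets of homs\<close>

definition finitely_evaluated ::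
  "'b binary_algebra \<Rightarrow> 'a binary_algebra \<Rightarrow> (('b \<Rightarrow> 'a) \<Rightarrow> 'a) \<Rightarrow> bool" where
  "finitely_evaluated A M f \<longleftrightarrow>
     (\<forall>X. finite X \<and> X \<subseteq> homs A M \<longrightarrow> (\<exists>a\<in>univ A. \<forall>x\<in>X. f x = x a))"

definition finitely_supported ::
  "'b binary_algebra \<Rightarrow> 'a binary_algebra \<Rightarrow> (('b \<Rightarrow> 'a) \<Rightarrow> 'a) \<Rightarrow> bool" where
  "finitely_supported A M f \<longleftrightarrow>
     (\<forall>x\<in>homs A M. \<exists>B. finite B \<and> B \<subseteq> univ A \<and>
        (\<forall>y\<in>homs A M. (\<forall>b\<in>B. y b = x b) \<longrightarrow> f y = f x))"

lemma finitely_supportedE: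
  assumes "finitely_supported A M f" and "x \<in> homs A M"
  obtains B where "finite B" "B \<subseteq> univ A" "\<forall>y\<in>homs A M. (\<forall>b\<in>B. y b = x b) \<longrightarrow> f y = f x"
  using bspec[OF assms(1)[unfolded finitely_supported_def] assms(2)]
  by (elim exE conjE) (rule that)

lemma homs_mult:
  "\<lbrakk>x \<in> homs A M; a \<in> univ A; b \<in> univ A\<rbrakk> \<Longrightarrow> x (a \<cdot>\<^bsub>A\<^esub> b) = x a \<cdot>\<^bsub>M\<^esub> x b"
  by (simp add: homs_def)

lemma homs_in_univ: "\<lbrakk>x \<in> homs A M; a \<in> univ A\<rbrakk> \<Longrightarrow> x a \<in> univ M"
  by (auto simp: homs_def)

lemma mult_in_univ: "\<lbrakk>is_algebra A; a \<in> univ A; b \<in> univ A\<rbrakk> \<Longrightarrow> a \<cdot>\<^bsub>A\<^esub> b \<in> univ A"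
  by (simp add: is_algebra_def)

text \<open>For a finite set of homs \<open>x\<^sub>1, \<dots>, x\<^sub>k\<close>, the tuples \<open>(x\<^sub>1 a, \<dots>, x\<^sub>k a)\<close> with \<open>a\<close> in \<open>A\<close> form
  a compatible relation, and preserving this relation means having an evaluation that agrees
  with \<open>f\<close> at all the \<open>x\<^sub>i\<close>. Conversely, such an evaluation transfers any relation from the
  \<open>x\<^sub>i\<close> to their values under \<open>f\<close>.\<close>

lemma preserves_all_iff_finitely_evaluated:
  assumes A: "is_algebra A"
  shows "(\<forall>k R. compatible_relation M k R \<longrightarrow> preserves A M f k R) \<longleftrightarrow> finitely_evaluated A M f"
proof
  assume pres: "\<forall>k R. compatible_relation M k R \<longrightarrow> preserves A M f k R"
  show "finitely_evaluated A M f"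
    unfolding finitely_evaluated_def
  proof (intro allI impI)
    fix X assume X: "finite X \<and> X \<subseteq> homs A M"
    show "\<exists>a\<in>univ A. \<forall>x\<in>X. f x = x a"
      \<comment> \<open>Relations of arity 0 are excluded, so the empty set of homs needs its own argument.\<close>
    proof (cases "X = {}")
      case True
      then show ?thesis using A by (auto simp: is_algebra_def)
    next
      case False
      obtain xs where xs: "set xs = X" using X finite_list by blast
      define k where "k = length xs"
      define R where "R = (\<lambda>a. \<lambda>i\<in>{..<k}. (xs ! i) a) ` univ A"
      have hom: "xs ! i \<in> homs A M" if "i < k" for i
        using that X xs k_def by (metis nth_mem subsetD)
      have "subuniverse (power_algebra M {..<k}) R"
        unfolding subuniverse_def
      proof (intro conjI ballI)
        show "R \<subseteq> univ (power_algebra M {..<k})"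
          by (auto simp: R_def power_algebra_def homs_in_univ[OF hom] split: if_splits)
        fix u v assume "u \<in> R" "v \<in> R"
        then obtain a b where ab: "a \<in> univ A" "b \<in> univ A"
          "u = (\<lambda>i\<in>{..<k}. (xs ! i) a)" "v = (\<lambda>i\<in>{..<k}. (xs ! i) b)"
          by (auto simp: R_def)
        then have "u \<cdot>\<^bsub>power_algebra M {..<k}\<^esub> v = (\<lambda>i\<in>{..<k}. (xs ! i) (a \<cdot>\<^bsub>A\<^esub> b))"
          by (auto simp: power_algebra_def homs_mult[OF hom] intro!: restrict_ext)
        then show "u \<cdot>\<^bsub>power_algebra M {..<k}\<^esub> v \<in> R"
          using mult_in_univ[OF A ab(1,2)] by (auto simp: R_def)
      qed
      moreover have "k \<ge> 1" using False xs k_def by (cases xs) auto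
      ultimately have "preserves A M f k R" using pres by (auto simp: compatible_relation_def)
      moreover have "\<forall>a\<in>univ A. (\<lambda>i\<in>{..<k}. (xs ! i) a) \<in> R" by (auto simp: R_def)
      ultimately have "(\<lambda>i\<in>{..<k}. f (xs ! i)) \<in> R"
        using hom unfolding preserves_def by (elim allE[of _ "\<lambda>i. xs ! i"]) blast
      then obtain a where a: "a \<in> univ A"
        "(\<lambda>i\<in>{..<k}. f (xs ! i)) = (\<lambda>i\<in>{..<k}. (xs ! i) a)"
        by (auto simp: R_def)
      have "f (xs ! i) = (xs ! i) a" if "i < k" for i
        using fun_cong[OF a(2), of i] that by simp
      then have "\<forall>x\<in>X. f x = x a" using xs k_def by (metis in_set_conv_nth)
      with a(1) show ?thesis by blast
    qed
  qed
next
  assume fe: "finitely_evaluated A M f"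
  show "\<forall>k R. compatible_relation M k R \<longrightarrow> preserves A M f k R"
    unfolding preserves_def
  proof (intro allI impI)
    fix k :: nat and R x
    assume x: "(\<forall>i<k. x i \<in> homs A M) \<and> (\<forall>a\<in>univ A. (\<lambda>i\<in>{..<k}. x i a) \<in> R)"
    then obtain a where a: "a \<in> univ A" "\<forall>y\<in>x ` {..<k}. f y = y a"
      using fe unfolding finitely_evaluated_def by (elim allE[of _ "x ` {..<k}"]) auto
    then have "(\<lambda>i\<in>{..<k}. f (x i)) = (\<lambda>i\<in>{..<k}. x i a)" by (auto intro: restrict_ext)
    then show "(\<lambda>i\<in>{..<k}. f (x i)) \<in> R" using x a(1) by auto
  qed
qed

lemma topspace_hom_topology: "topspace (hom_topology A M) = homs A M"
  by (auto simp: hom_topology_def homs_def)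

lemma continuous_iff_finitely_supported:
  fixes M :: "'a binary_algebra" and A :: "'b binary_algebra" and f :: "('b \<Rightarrow> 'a) \<Rightarrow> 'a"
  shows
  "continuous_map (hom_topology A M) (discrete_topology (univ M)) f \<longleftrightarrow>
     f \<in> homs A M \<rightarrow> univ M \<and> finitely_supported A M f"
  (is "?cont \<longleftrightarrow> ?maps \<and> ?fs")
proof
  let ?supp = "\<lambda>x. \<exists>B. finite B \<and> B \<subseteq> univ A \<and> (\<forall>y\<in>homs A M. (\<forall>b\<in>B. y b = x b) \<longrightarrow> f y = f x)"
  assume cont: ?cont
  then have maps: ?maps
    using continuous_map_image_subset_topspace[OF cont] by (auto simp: topspace_hom_topology)
  have "?supp x" if x: "x \<in> homs A M" for x
  proof -
    have "openin (hom_topology A M) {y \<in> homs A M. f y \<in> {f x}}"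
      using openin_continuous_map_preimage[OF cont, of "{f x}"] maps x
      by (auto simp: topspace_hom_topology)
    then obtain T where T: "openin (product_topology (\<lambda>_. discrete_topology (univ M)) (univ A)) T"
      "{y \<in> homs A M. f y \<in> {f x}} = T \<inter> homs A M"
      unfolding hom_topology_def openin_subtopology by blast
    then have "x \<in> T" using x by auto
    then obtain U where U: "finite {i \<in> univ A. U i \<noteq> univ M}" "x \<in> Pi\<^sub>E (univ A) U"
      "Pi\<^sub>E (univ A) U \<subseteq> T"
      using T(1) unfolding openin_product_topology_alt by auto
    have "f y = f x" if y: "y \<in> homs A M" "\<forall>b\<in>{i \<in> univ A. U i \<noteq> univ M}. y b = x b" for y
    proof -
      have "y i \<in> U i" if "i \<in> univ A" for i
      proof (cases "U i = univ M")
        case True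
        then show ?thesis using homs_in_univ[OF y(1) that] by simp
      next
        case False
        then have "y i = x i" using y(2) that by blast
        then show ?thesis using U(2) that by auto
      qed
      then have "y \<in> Pi\<^sub>E (univ A) U" using y(1) by (auto simp: homs_def)
      then show ?thesis using U(3) T(2) y(1) by blast
    qed
    then show ?thesis using U(1) by (intro exI[of _ "{i \<in> univ A. U i \<noteq> univ M}"]) blast
  qed
  with maps show "?maps \<and> ?fs" unfolding finitely_supported_def by blast
next
  assume R': "?maps \<and> ?fs"
  note R = R'[unfolded finitely_supported_def]
  show ?cont
    unfolding continuous_map
  proof (intro conjI allI impI)
    show "f ` topspace (hom_topology A M) \<subseteq> topspace (discrete_topology (univ M))"
      using R by (auto simp: topspace_hom_topology)
    fix W :: "'a set"
    show "openin (hom_topology A M) {x \<in> topspace (hom_topology A M). f x \<in> W}"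
    proof (subst openin_subopen, intro ballI)
      fix x assume "x \<in> {x \<in> topspace (hom_topology A M). f x \<in> W}"
      then have x: "x \<in> homs A M" "f x \<in> W" by (auto simp: topspace_hom_topology)
      then obtain B where B: "finite B" "B \<subseteq> univ A"
        "\<forall>y\<in>homs A M. (\<forall>b\<in>B. y b = x b) \<longrightarrow> f y = f x"
        using R by blast
      define T where "T = (\<Pi>\<^sub>E b\<in>univ A. if b \<in> B then {x b} else univ M)"
      have "openin (product_topology (\<lambda>_. discrete_topology (univ M)) (univ A)) T"
        unfolding T_def
      proof (rule product_topology_basis)
        show "openin (discrete_topology (univ M)) (if b \<in> B then {x b} else univ M)" for b
          using homs_in_univ[OF x(1)] B(2) by auto
        show "finite {b. (if b \<in> B then {x b} else univ M) \<noteq> topspace (discrete_topology (univ M))}"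
          by (rule finite_subset[OF _ B(1)]) auto
      qed
      then have "openin (hom_topology A M) (T \<inter> homs A M)"
        by (auto simp: hom_topology_def openin_subtopology)
      moreover have "x \<in> T \<inter> homs A M"
        using x(1) by (auto simp: T_def homs_def)
      moreover have "T \<inter> homs A M \<subseteq> {x \<in> topspace (hom_topology A M). f x \<in> W}"
      proof
        fix y assume y: "y \<in> T \<inter> homs A M"
        have "y b = x b" if "b \<in> B" for b
        proof -
          have "y b \<in> (if b \<in> B then {x b} else univ M)"
            using y that B(2) unfolding T_def by (auto dest!: PiE_mem)
          then show ?thesis using that by simp
        qed
        then have "f y = f x" using B(3) y by blast
        then show "y \<in> {x \<in> topspace (hom_topology A M). f x \<in> W}"
          using y x by (simp add: topspace_hom_topology)
      qed
      ultimately show "\<exists>T'. openin (hom_topology A M) T' \<and> x \<in> T' \<and>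
          T' \<subseteq> {x \<in> topspace (hom_topology A M). f x \<in> W}"
        by blast
    qed
  qed
qed


section \<open>Ghost elements\<close>

text \<open>The ghost of a sequence \<open>d\<close> is its pointwise limit \<open>g\<close> in the power of \<open>M\<close>. Since every hom
  is constant on the sequence up to one exception, sending a hom to its common value on the
  sequence is supported by three elements and is an evaluation at some \<open>d i\<close> on every finite set
  of homs. At the coordinate projections it takes the values of \<open>g\<close>, so only \<open>g\<close> could evaluate
  it.\<close>

lemma nondualizable_if_ghost:
  fixes M :: "'a binary_algebra" and S :: "('c::countable \<Rightarrow> 'a) set"
    and d :: "nat \<Rightarrow> 'c \<Rightarrow> 'a" and g :: "'c \<Rightarrow> 'a"
  assumes inf_i: "infinite (UNIV :: 'i set)" and inf_b: "infinite (UNIV :: 'b set)"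
    and S: "countable S" "subuniverse (power_algebra M UNIV) S"
    and d: "\<And>i. d i \<in> S"
    and hom: "\<And>x. x \<in> homs ((power_algebra M UNIV)\<lparr>univ := S\<rparr>) M \<Longrightarrow>
          \<exists>k. \<forall>i j. i \<noteq> k \<longrightarrow> j \<noteq> k \<longrightarrow> x (d i) = x (d j)"
    and g: "\<And>c. \<exists>k. \<forall>i. i \<noteq> k \<longrightarrow> d i c = g c" and "g \<notin> S"
  shows "\<not> dualizable TYPE('i) TYPE('b) M"
proof
  assume dual: "dualizable TYPE('i) TYPE('b) M"
  let ?P = "(power_algebra M UNIV)\<lparr>univ := S\<rparr>"
  \<comment> \<open>Countability lets the algebra be copied into \<open>'b\<close> and its exponent into \<open>'i\<close>.\<close>
  obtain e :: "nat \<Rightarrow> 'b" where e: "inj e"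
    using inf_b infinite_countable_subset by blast
  define \<psi> where "\<psi> = e \<circ> to_nat_on S"
  have inj\<psi>: "inj_on \<psi> S"
    using S(1) e by (auto simp: \<psi>_def intro: comp_inj_on inj_on_to_nat_on inj_on_subset)
  define \<theta> where "\<theta> = the_inv_into S \<psi>"
  have \<theta>\<psi>: "\<theta> (\<psi> w) = w" if "w \<in> S" for w
    using that inj\<psi> by (simp add: \<theta>_def the_inv_into_f_f)
  have Smult: "u \<cdot>\<^bsub>?P\<^esub> v \<in> S" if "u \<in> S" "v \<in> S" for u v
    using that S(2) by (auto simp: subuniverse_def)
  have Suniv: "w c \<in> univ M" if "w \<in> S" for w c
    using that S(2) by (auto simp: subuniverse_def power_algebra_def)
  have Pmult: "(u \<cdot>\<^bsub>?P\<^esub> v) c = u c \<cdot>\<^bsub>M\<^esub> v c" for u v c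
    by (simp add: power_algebra_def)
  define A :: "'b binary_algebra" where
    "A = \<lparr>univ = \<psi> ` S, mult = (\<lambda>a b. \<psi> (\<theta> a \<cdot>\<^bsub>?P\<^esub> \<theta> b))\<rparr>"
  have univA: "univ A = \<psi> ` S" by (simp add: A_def)
  have multA: "\<psi> u \<cdot>\<^bsub>A\<^esub> \<psi> v = \<psi> (u \<cdot>\<^bsub>?P\<^esub> v)" if "u \<in> S" "v \<in> S" for u v
    using that by (simp add: A_def \<theta>\<psi>)
  have algA: "is_algebra A"
    using d[of 0] Smult by (auto simp: is_algebra_def univA multA)

  obtain e' :: "nat \<Rightarrow> 'i" where e': "inj e'"
    using inf_i infinite_countable_subset by blast
  define \<phi> where "\<phi> = e' \<circ> (to_nat :: 'c \<Rightarrow> nat)"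
  have inj\<phi>: "inj \<phi>"
    using e' by (auto simp: \<phi>_def intro: inj_compose)
  define I where "I = range \<phi>"
  define \<rho> where "\<rho> = (\<lambda>w :: 'c \<Rightarrow> 'a. \<lambda>i\<in>I. w (inv \<phi> i))"
  have inj\<rho>: "inj \<rho>"
  proof (rule injI, rule ext)
    fix u v c assume "\<rho> u = \<rho> v"
    from fun_cong[OF this, of "\<phi> c"] show "u c = v c"
      by (simp add: \<rho>_def I_def inv_f_f[OF inj\<phi>])
  qed
  have \<rho>mult: "\<rho> (u \<cdot>\<^bsub>?P\<^esub> v) = \<rho> u \<cdot>\<^bsub>power_algebra M I\<^esub> \<rho> v" for u v
    by (auto simp: \<rho>_def power_algebra_def intro: restrict_ext)
  have "isomorphic A ((power_algebra M I)\<lparr>univ := \<rho> ` S\<rparr>)"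
    unfolding isomorphic_def
  proof (intro bexI)
    let ?h = "\<lambda>a\<in>univ A. \<rho> (\<theta> a)"
    show "bij_betw ?h (univ A) (univ ((power_algebra M I)\<lparr>univ := \<rho> ` S\<rparr>))"
      unfolding bij_betw_def
      by (auto simp: univA inj_on_def \<theta>\<psi> image_image dest: injD[OF inj\<rho>])
    show "?h \<in> homs A ((power_algebra M I)\<lparr>univ := \<rho> ` S\<rparr>)"
      unfolding homs_def using Smult \<rho>mult
      by (auto simp: univA multA \<theta>\<psi> power_algebra_def)
  qed
  moreover have "subuniverse (power_algebra M I) (\<rho> ` S)"
    unfolding subuniverse_def
  proof (intro conjI ballI)
    show "\<rho> ` S \<subseteq> univ (power_algebra M I)"
      using Suniv by (auto simp: \<rho>_def power_algebra_def)
    show "u \<cdot>\<^bsub>power_algebra M I\<^esub> v \<in> \<rho> ` S" if "u \<in> \<rho> ` S" "v \<in> \<rho> ` S" for u v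
      using that Smult by (auto simp: \<rho>mult[symmetric])
  qed
  moreover have "\<rho> ` S \<noteq> {}" using d by blast
  ultimately have "\<exists>(I :: 'i set) S. S \<noteq> {} \<and> subuniverse (power_algebra M I) S \<and>
      isomorphic A ((power_algebra M I)\<lparr>univ := S\<rparr>)"
    by (intro exI[of _ I] exI[of _ "\<rho> ` S"] conjI)
  with algA have "A \<in> ISP TYPE('i) M" unfolding ISP_def by (intro CollectI conjI)
  then have eval: "evaluation A M f"
    if "continuous_map (hom_topology A M) (discrete_topology (univ M)) f" "finitely_evaluated A M f"
    for f
    using dual that preserves_all_iff_finitely_evaluated[OF algA]
    unfolding dualizable_def by blast

  have homA: "\<exists>k. \<forall>i j. i \<noteq> k \<longrightarrow> j \<noteq> k \<longrightarrow> x (\<psi> (d i)) = x (\<psi> (d j))"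
    if x: "x \<in> homs A M" for x
  proof -
    have "restrict (x \<circ> \<psi>) S \<in> homs ?P M"
      unfolding homs_def
    proof (intro CollectI conjI ballI)
      show "restrict (x \<circ> \<psi>) S \<in> univ ?P \<rightarrow>\<^sub>E univ M"
        using homs_in_univ[OF x] by (auto simp: univA)
      show "restrict (x \<circ> \<psi>) S (u \<cdot>\<^bsub>?P\<^esub> v) = restrict (x \<circ> \<psi>) S u \<cdot>\<^bsub>M\<^esub> restrict (x \<circ> \<psi>) S v"
        if "u \<in> univ ?P" "v \<in> univ ?P" for u v
        using that Smult[of u v] homs_mult[OF x, of "\<psi> u" "\<psi> v"] by (simp add: univA multA)
    qed
    from hom[OF this] show ?thesis using d by simp
  qed
  \<comment> \<open>At most one of the values at \<open>d 0\<close>, \<open>d 1\<close>, \<open>d 2\<close> is exceptional, so this is a majority vote.\<close>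
  define f where "f = (\<lambda>x :: 'b \<Rightarrow> 'a. let x' = (\<lambda>i. x (\<psi> (d i))) in if x' 0 = x' 1 then x' 0 else x' 2)"
  have f_eq: "\<exists>k. \<forall>i. i \<noteq> k \<longrightarrow> f x = x (\<psi> (d i))" if x: "x \<in> homs A M" for x
  proof -
    obtain k where k: "\<And>i j. i \<noteq> k \<Longrightarrow> j \<noteq> k \<Longrightarrow> x (\<psi> (d i)) = x (\<psi> (d j))"
      using homA[OF x] by blast
    have "f x = x (\<psi> (d i))" if i: "i \<noteq> k" for i
    proof (cases "k = 0 \<or> k = 1")
      case True
      then have "x (\<psi> (d 2)) = x (\<psi> (d i))" "x (\<psi> (d (1 - k))) = x (\<psi> (d i))"
        using i by (auto intro!: k)
      then show ?thesis using True by (auto simp: f_def)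
    next
      case False
      then have "x (\<psi> (d 0)) = x (\<psi> (d i))" "x (\<psi> (d 1)) = x (\<psi> (d i))"
        using i by (auto intro!: k)
      then show ?thesis by (auto simp: f_def)
    qed
    then show ?thesis by blast
  qed
  have \<psi>d: "\<psi> (d i) \<in> univ A" for i using d by (simp add: univA)
  have "f \<in> homs A M \<rightarrow> univ M"
    using homs_in_univ[OF _ \<psi>d] by (auto simp: f_def Let_def)
  moreover have "finitely_supported A M f"
    unfolding finitely_supported_def
    using \<psi>d by (intro ballI exI[of _ "(\<lambda>i. \<psi> (d i)) ` {0, 1, 2}"]) (auto simp: f_def Let_def)
  ultimately have "continuous_map (hom_topology A M) (discrete_topology (univ M)) f"
    unfolding continuous_iff_finitely_supported by blast
  moreover have "finitely_evaluated A M f"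
    unfolding finitely_evaluated_def
  proof (intro allI impI)
    fix X assume X: "finite X \<and> X \<subseteq> homs A M"
    then obtain k where k: "\<And>x i. x \<in> X \<Longrightarrow> i \<noteq> k x \<Longrightarrow> f x = x (\<psi> (d i))"
      using f_eq by (metis subsetD)
    obtain i where "i \<notin> k ` X" using X infinite_UNIV_nat ex_new_if_finite by blast
    then show "\<exists>a\<in>univ A. \<forall>x\<in>X. f x = x a"
      using k \<psi>d by (intro bexI[of _ "\<psi> (d i)"]) auto
  qed
  ultimately obtain w where w: "w \<in> S" "\<And>x. x \<in> homs A M \<Longrightarrow> f x = x (\<psi> w)"
    using eval[of f] unfolding evaluation_def univA by blast
  have "w c = g c" for c
  proof -
    define \<pi> where "\<pi> = (\<lambda>a\<in>univ A. \<theta> a c)"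
    have \<pi>: "\<pi> \<in> homs A M"
      using Suniv Smult Pmult by (auto simp: homs_def \<pi>_def univA multA \<theta>\<psi>)
    obtain k k' where k: "\<And>i. i \<noteq> k \<Longrightarrow> f \<pi> = \<pi> (\<psi> (d i))" "\<And>i. i \<noteq> k' \<Longrightarrow> d i c = g c"
      using f_eq[OF \<pi>] g[of c] by blast
    obtain i where "i \<notin> {k, k'}" using infinite_UNIV_nat ex_new_if_finite[of "{k, k'}"] by blast
    then have "i \<noteq> k" "i \<noteq> k'" by auto
    moreover have "\<pi> (\<psi> (d i)) = d i c" using d by (simp add: \<pi>_def univA \<theta>\<psi>)
    ultimately have "f \<pi> = g c" using k by simp
    then show ?thesis using w(2)[OF \<pi>] w(1) by (simp add: \<pi>_def univA \<theta>\<psi>)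
  qed
  then have "w = g" by blast
  with w(1) \<open>g \<notin> S\<close> show False by blast
qed


section \<open>Algebras with one letter\<close>

text \<open>The partial action of the letter on the states is made total with the value \<open>z\<close>; the map
  \<open>\<alpha>\<close> below is this total action.\<close>

locale one_letter_algebra =
  fixes M :: "'a binary_algebra" and l z :: 'a
  assumes finite_univ: "finite (univ M)"
    and letter: "l \<in> univ M" and zero: "z \<in> univ M" and letter_neq_zero: "l \<noteq> z"
    and mult_nonletter: "\<lbrakk>u \<in> univ M; v \<in> univ M; v \<noteq> l\<rbrakk> \<Longrightarrow> u \<cdot>\<^bsub>M\<^esub> v = z"
    and mult_letter: "u \<in> univ M \<Longrightarrow> u \<cdot>\<^bsub>M\<^esub> l \<in> univ M - {l}"
    and zero_mult_letter: "z \<cdot>\<^bsub>M\<^esub> l = z" and letter_mult_letter: "l \<cdot>\<^bsub>M\<^esub> l = z"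
begin

definition \<alpha> :: "'a \<Rightarrow> 'a" where "\<alpha> u = u \<cdot>\<^bsub>M\<^esub> l"

lemma mult_eq: "\<lbrakk>u \<in> univ M; v \<in> univ M\<rbrakk> \<Longrightarrow> u \<cdot>\<^bsub>M\<^esub> v = (if v = l then \<alpha> u else z)"
  by (simp add: mult_nonletter \<alpha>_def)

lemma \<alpha>_zero [simp]: "\<alpha> z = z" and \<alpha>_letter [simp]: "\<alpha> l = z"
  by (simp_all add: \<alpha>_def zero_mult_letter letter_mult_letter)

lemma \<alpha>_in_univ [simp]: "u \<in> univ M \<Longrightarrow> \<alpha> u \<in> univ M"
  and \<alpha>_neq_letter [simp]: "u \<in> univ M \<Longrightarrow> \<alpha> u \<noteq> l"
  using mult_letter by (auto simp: \<alpha>_def)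

lemma funpow_\<alpha>_in_univ: "u \<in> univ M \<Longrightarrow> (\<alpha> ^^ n) u \<in> univ M"
  by (induction n) auto

end


section \<open>A non-periodic image makes the algebra non-dualizable\<close>

text \<open>The coordinates of the witness. Each \<open>Row i\<close> and \<open>Col i\<close> tells one element of a
  sequence apart from the others; at \<open>Limit\<close> they all look the same, and the ghost is nonzero
  at \<open>Limit\<close> only.\<close>

datatype coord = Limit | Row nat | Col nat

instance coord :: countable
  by countable_datatype

context one_letter_algebra
begin

definition spot :: "'a \<Rightarrow> 'a \<Rightarrow> coord \<Rightarrow> coord \<Rightarrow> 'a" where
  "spot u v c = (\<lambda>c'. if c' = Limit then u else if c' = c then v else z)"

definition common_letter :: "coord \<Rightarrow> 'a" where
  "common_letter c = (case c of Col _ \<Rightarrow> z | _ \<Rightarrow> l)"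

definition own_letter :: "nat \<Rightarrow> coord \<Rightarrow> 'a" where
  "own_letter i c = (case c of Limit \<Rightarrow> l | Row j \<Rightarrow> if j = i then l else z
     | Col j \<Rightarrow> if j = i then l else z)"

definition source :: "'a \<Rightarrow> nat \<Rightarrow> coord \<Rightarrow> 'a" where
  "source q i c = (case c of Limit \<Rightarrow> q | Row j \<Rightarrow> if j = i then q else z
     | Col j \<Rightarrow> if j = i then z else q)"

text \<open>Let \<open>r = \<alpha> q\<close> and let \<open>P\<close> be the power of \<open>M\<close> over \<open>coord\<close>. The source \<open>q i\<close> times the
  common letter, and also times its own letter \<open>i\<close>, is the spot \<open>d i\<close> with \<open>r\<close> at \<open>Limit\<close> and \<open>Row i\<close>;
  all other sources times the own letter \<open>i\<close> give one and the same element \<open>e i\<close>, the spot with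
  \<open>r\<close> at \<open>Limit\<close> and \<open>Col i\<close>. These coincidences bind the homs: if some own letter \<open>k\<close> goes to \<open>l\<close>,
  then \<open>e k\<close> determines what happens to every source except that of index \<open>k\<close>, and so the
  \<open>d j\<close> with \<open>j \<noteq> k\<close> have one value; if none does, then all \<open>d j\<close> go to \<open>z\<close>. The ghost of the
  sequence \<open>d\<close> has \<open>r\<close> at \<open>Limit\<close> and \<open>z\<close> elsewhere. Further multiplication by letters does not
  produce it, since this replaces \<open>r\<close> at \<open>Limit\<close> by a proper iterate of \<open>\<alpha>\<close> at \<open>r\<close>,
  and \<open>r\<close> is not periodic.\<close>

lemma nondualizable_if_not_periodic:
  fixes q :: 'a
  assumes inf_i: "infinite (UNIV :: 'i set)" and inf_b: "infinite (UNIV :: 'b set)"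
    and q: "q \<in> univ M" and aper: "\<And>n. n \<ge> 1 \<Longrightarrow> (\<alpha> ^^ n) (\<alpha> q) \<noteq> \<alpha> q"
  shows "\<not> dualizable TYPE('i) TYPE('b) M"
proof -
  define P where "P = power_algebra M (UNIV :: coord set)"
  define r where "r = \<alpha> q"
  define C where "C = insert z {(\<alpha> ^^ n) r | n. n \<ge> 1}"
  have r: "r \<in> univ M" "r \<noteq> l" using q by (simp_all add: r_def)
  have "z \<noteq> r"
  proof
    assume "z = r"
    then have "\<alpha> r = r" using \<alpha>_zero by metis
    then show False using aper[of 1] by (simp add: r_def)
  qed
  then have rC: "r \<notin> C" using aper by (force simp: C_def r_def)
  have ql: "q \<noteq> l" using \<open>z \<noteq> r\<close> by (auto simp: r_def)
  have qr: "q \<noteq> r" using aper[of 1] by (auto simp: r_def)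
  have CM: "C \<subseteq> univ M" using r zero funpow_\<alpha>_in_univ by (auto simp: C_def)
  have lC: "l \<notin> C"
  proof
    assume "l \<in> C"
    then obtain n where "n \<ge> 1" "l = (\<alpha> ^^ n) r" using letter_neq_zero by (auto simp: C_def)
    then show False using \<alpha>_neq_letter[OF funpow_\<alpha>_in_univ[OF r(1)], of "n - 1"] by (cases n) auto
  qed
  have \<alpha>C: "\<alpha> u \<in> C" if "u \<in> insert r C" for u
  proof -
    have "\<exists>m\<ge>1. \<alpha> ((\<alpha> ^^ n) r) = (\<alpha> ^^ m) r" for n by (rule exI[of _ "Suc n"]) simp
    then show ?thesis using that unfolding C_def
      by (auto intro: exI[of _ 1])
  qed

  \<comment> \<open>\<open>D\<close> contains more than the generated elements, which keeps the closure proof short; what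
    matters is that it is countable and avoids the value \<open>r\<close> at \<open>Limit\<close>.\<close>
  define D where "D = (\<lambda>(u, v, c). spot u v c) ` (C \<times> (univ M - {l}) \<times> UNIV)"
  define L where "L = insert common_letter (range own_letter)"
  define T where "T = D \<union> range (\<lambda>i. spot r r (Row i)) \<union> range (\<lambda>i. spot r r (Col i))"
  define S where "S = range (source q) \<union> L \<union> T"
  note gens = common_letter_def own_letter_def source_def spot_def

  have mult: "(u \<cdot>\<^bsub>P\<^esub> v) c = (if v c = l then \<alpha> (u c) else z)"
    if "u c \<in> univ M" "v c \<in> univ M" for u v c
    using that by (simp add: P_def power_algebra_def mult_eq)
  have T_univ: "w c \<in> univ M - {l}" if "w \<in> T" for w c
    using that r CM zero letter_neq_zero lC
    by (auto simp: T_def D_def spot_def split: if_splits)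
  have L_cases: "w c = l \<or> w c = z" if "w \<in> L" for w c
    using that by (auto simp: L_def gens split: coord.splits)
  have S_cases: "w \<in> range (source q) \<or> w \<in> L \<or> w \<in> T" if "w \<in> S" for w
    using that by (simp add: S_def)
  have p_univ: "w c \<in> univ M - {l}" if "w \<in> range (source q)" for w c
    using that q ql zero letter_neq_zero by (auto simp: gens split: coord.splits if_splits)
  have S_univ: "w c \<in> univ M" if "w \<in> S" for w c
    using S_cases[OF that] T_univ[of w c] p_univ[of w c] L_cases[of w c] zero letter by auto
  have spot_D: "spot u v c \<in> D" if "u \<in> C" "v \<in> univ M - {l}" for u v c
    unfolding D_def by (rule image_eqI[of _ _ "(u, v, c)"]) (use that in auto)
  have "spot z z Limit = (\<lambda>c. z)" by (auto simp: spot_def)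
  moreover have "spot z z Limit \<in> D" by (rule spot_D) (use zero letter_neq_zero in \<open>auto simp: C_def\<close>)
  ultimately have zero_D: "(\<lambda>c. z) \<in> D" by simp

  have source_common: "source q i \<cdot>\<^bsub>P\<^esub> common_letter = spot r r (Row i)" for i
    by (rule ext) (auto simp: mult q zero letter letter_neq_zero[symmetric] gens r_def split: coord.splits)
  have source_own: "source q i \<cdot>\<^bsub>P\<^esub> own_letter j = (if i = j then spot r r (Row i) else spot r r (Col j))" for i j
    by (rule ext) (auto simp: mult q zero letter letter_neq_zero[symmetric] gens r_def split: coord.splits)

  have closed: "u \<cdot>\<^bsub>P\<^esub> v \<in> S" if uv: "u \<in> S" "v \<in> S" for u v
  proof -
    consider "u \<in> L \<or> v \<notin> L" | "u \<in> range (source q)" "v \<in> L" | "u \<in> T" "v \<in> L"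
      using S_cases[OF uv(1)] by blast
    then show ?thesis
    proof cases
      case 1
      then have "u \<cdot>\<^bsub>P\<^esub> v = (\<lambda>c. z)"
        using S_univ[OF uv(1)] S_univ[OF uv(2)] L_cases[of u] S_cases[OF uv(2)] T_univ[of v] p_univ[of v]
        by (intro ext) (auto simp: mult, (metis \<alpha>_zero \<alpha>_letter)+)
      then show ?thesis using zero_D by (simp add: S_def T_def)
    next
      case 2
      then show ?thesis by (auto simp: L_def S_def T_def source_common source_own)
    next
      case 3
      then obtain x y c where u: "u = spot x y c" "x \<in> insert r C" "y \<in> univ M - {l}"
        using r by (auto simp: T_def D_def)
      have "v Limit = l" using 3 by (auto simp: L_def gens)
      then have "u \<cdot>\<^bsub>P\<^esub> v = spot (\<alpha> x) (if v c = l then \<alpha> y else z) c"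
        using S_univ[OF uv(1)] S_univ[OF uv(2)] by (intro ext) (auto simp: mult u(1) spot_def)
      moreover have "\<dots> \<in> D"
        by (rule spot_D[OF \<alpha>C[OF u(2)]]) (use u(3) zero letter_neq_zero in auto)
      ultimately show ?thesis by (simp add: S_def T_def)
    qed
  qed
  have sub: "subuniverse P S"
    unfolding subuniverse_def using closed S_univ by (auto simp: P_def power_algebra_def)
  have "countable (C \<times> (univ M - {l}) \<times> (UNIV :: coord set))"
    using finite_univ CM by (intro countable_SIGMA) (auto intro: countable_finite finite_subset)
  then have "countable S" by (auto simp: S_def L_def T_def D_def)
  have memS: "spot r r (Row i) \<in> S" "spot r r (Col i) \<in> S" "source q i \<in> S"
    "own_letter i \<in> S" "common_letter \<in> S" for i
    by (auto simp: S_def T_def L_def)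
  show ?thesis
  proof (rule nondualizable_if_ghost[where M = M and S = S and d = "\<lambda>i. spot r r (Row i)" and g = "spot r z Limit"])
    fix x assume "x \<in> homs ((power_algebra M UNIV)\<lparr>univ := S\<rparr>) M"
    then have x: "x \<in> homs (P\<lparr>univ := S\<rparr>) M" by (simp add: P_def)
    have x_mult: "x (u \<cdot>\<^bsub>P\<^esub> v) = (if x v = l then \<alpha> (x u) else z)" if "u \<in> S" "v \<in> S" for u v
      using homs_mult[OF x, of u v] homs_in_univ[OF x, of u] homs_in_univ[OF x, of v] that
      by (simp add: mult_eq)
    have common: "x (spot r r (Row j)) = (if x common_letter = l then \<alpha> (x (source q j)) else z)" for j
      using x_mult[OF memS(3)[of j] memS(5)] by (simp add: source_common)
    have own: "x (spot r r (Row j)) = (if x (own_letter j) = l then \<alpha> (x (source q j)) else z)" for j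
      using x_mult[OF memS(3)[of j] memS(4)[of j]] by (simp add: source_own)
    have other: "x (spot r r (Col i)) = (if x (own_letter i) = l then \<alpha> (x (source q j)) else z)" if "j \<noteq> i" for i j
      using x_mult[OF memS(3)[of j] memS(4)[of i]] that by (simp add: source_own)
    show "\<exists>k. \<forall>i j. i \<noteq> k \<longrightarrow> j \<noteq> k \<longrightarrow> x (spot r r (Row i)) = x (spot r r (Row j))"
    proof (cases "\<exists>k. x (own_letter k) = l")
      case True
      then obtain k where "x (own_letter k) = l" by blast
      then have "\<alpha> (x (source q j)) = x (spot r r (Col k))" if "j \<noteq> k" for j
        using other[OF that] by simp
      then show ?thesis by (intro exI[of _ k]) (simp add: common)
    next
      case False
      then show ?thesis by (simp add: own)
    qed
  next
    show "\<exists>k. \<forall>i. i \<noteq> k \<longrightarrow> spot r r (Row i) c = spot r z Limit c" for c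
      by (cases c) (auto simp: spot_def)
  next
    show "spot r z Limit \<notin> S"
    proof
      assume "spot r z Limit \<in> S"
      then consider i where "spot r z Limit = source q i" | "spot r z Limit \<in> L" | "spot r z Limit \<in> D"
        | i where "spot r z Limit = spot r r (Row i)" | i where "spot r z Limit = spot r r (Col i)"
        by (auto simp: S_def T_def)
      then show False
      proof cases
        case 1
        from fun_cong[OF 1, of Limit] show False using qr by (simp add: gens)
      next
        case 2
        from L_cases[OF 2, of Limit] show False using r(2) \<open>z \<noteq> r\<close> by (auto simp: spot_def)
      next
        case 3
        then obtain x y c where "spot r z Limit = spot x y c" "x \<in> C" by (auto simp: D_def)
        with rC fun_cong[OF this(1), of Limit] show False by (simp add: spot_def)
      next
        case (4 i)
        from fun_cong[OF 4, of "Row i"] show False using \<open>z \<noteq> r\<close> by (simp add: spot_def)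
      next
        case (5 i)
        from fun_cong[OF 5, of "Col i"] show False using \<open>z \<noteq> r\<close> by (simp add: spot_def)
      qed
    qed
  qed (use \<open>countable S\<close> sub memS inf_i inf_b in \<open>simp_all add: P_def\<close>)
qed

end


section \<open>Periodic images: changing homs\<close>

locale whiskery_one_letter_algebra = one_letter_algebra +
  fixes N :: nat
  assumes N_pos: "N \<ge> 1" and periodic: "u \<in> univ M \<Longrightarrow> (\<alpha> ^^ N) (\<alpha> u) = \<alpha> u"
begin

text \<open>\<open>core\<close> retracts the states and \<open>z\<close> onto the image of \<open>\<alpha>\<close>: it moves a whisker to the
  point of the cycle with the same image under \<open>\<alpha>\<close>.\<close>

definition core :: "'a \<Rightarrow> 'a" where "core = \<alpha> ^^ N"

lemma core_\<alpha>: "u \<in> univ M \<Longrightarrow> core (\<alpha> u) = \<alpha> u"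
  by (simp add: core_def periodic)

lemma \<alpha>_core: "u \<in> univ M \<Longrightarrow> \<alpha> (core u) = \<alpha> u"
  using core_\<alpha>[of u] by (simp add: core_def funpow_swap1)

lemma core_in_image: "u \<in> univ M \<Longrightarrow> core u \<in> \<alpha> ` univ M"
proof -
  assume u: "u \<in> univ M"
  obtain n where "N = Suc n" using N_pos by (cases N) auto
  then have "core u = \<alpha> ((\<alpha> ^^ n) u)" unfolding core_def by simp
  then show ?thesis using funpow_\<alpha>_in_univ[OF u] by blast
qed

lemma core_image: "u \<in> \<alpha> ` univ M \<Longrightarrow> core u = u"
  using core_\<alpha> by auto

lemma core_eq_if_\<alpha>_eq: "\<alpha> u = \<alpha> v \<Longrightarrow> core u = core v"
proof -
  assume eq: "\<alpha> u = \<alpha> v"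
  obtain n where "N = Suc n" using N_pos by (cases N) auto
  then have "core w = (\<alpha> ^^ n) (\<alpha> w)" for w unfolding core_def by (simp add: funpow_swap1)
  with eq show ?thesis by simp
qed

lemma \<alpha>_inj_on_image: "\<lbrakk>u \<in> \<alpha> ` univ M; v \<in> \<alpha> ` univ M; \<alpha> u = \<alpha> v\<rbrakk> \<Longrightarrow> u = v"
  using core_eq_if_\<alpha>_eq[of u v] core_image by auto

lemma core_zero [simp]: "core z = z" and core_letter [simp]: "core l = z"
  using core_eq_if_\<alpha>_eq[of l z] zero core_\<alpha>[of z] by simp_all

lemma \<alpha>_eq_zero_iff: "u \<in> \<alpha> ` univ M \<Longrightarrow> \<alpha> u = z \<longleftrightarrow> u = z"
proof -
  assume u: "u \<in> \<alpha> ` univ M"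
  have "z \<in> \<alpha> ` univ M" using zero by (intro rev_image_eqI[of z]) simp_all
  then show ?thesis using \<alpha>_inj_on_image[OF u] \<alpha>_zero by metis
qed

lemma homs_mult_eq:
  "\<lbrakk>x \<in> homs A M; a \<in> univ A; b \<in> univ A\<rbrakk> \<Longrightarrow> x (a \<cdot>\<^bsub>A\<^esub> b) = (if x b = l then \<alpha> (x a) else z)"
  by (simp add: homs_mult mult_eq homs_in_univ)

lemma homsI:
  assumes A: "is_algebra A" and "x \<in> univ A \<rightarrow>\<^sub>E univ M"
    and "\<And>a b. \<lbrakk>a \<in> univ A; b \<in> univ A\<rbrakk> \<Longrightarrow> x (a \<cdot>\<^bsub>A\<^esub> b) = (if x b = l then \<alpha> (x a) else z)"
  shows "x \<in> homs A M"
  unfolding homs_def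
proof (intro CollectI conjI ballI)
  fix a b assume "a \<in> univ A" "b \<in> univ A"
  then show "x (a \<cdot>\<^bsub>A\<^esub> b) = x a \<cdot>\<^bsub>M\<^esub> x b"
    using assms(2,3) PiE_mem[OF assms(2)] by (simp add: mult_eq)
qed (rule assms(2))

text \<open>\<open>cut A S x\<close> is \<open>x\<close> with everything outside \<open>S\<close> erased. In the ordering of \<open>M\<close> with \<open>z\<close> below
  all other, mutually incomparable elements, cuts are the maps below \<open>x\<close>.\<close>

definition cut :: "'b binary_algebra \<Rightarrow> 'b set \<Rightarrow> ('b \<Rightarrow> 'a) \<Rightarrow> 'b \<Rightarrow> 'a" where
  "cut A S x = (\<lambda>a\<in>univ A. if a \<in> S then x a else z)"

lemma cut_homs:
  assumes A: "is_algebra A" and x: "x \<in> homs A M"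
    and S: "\<And>a b. \<lbrakk>a \<in> univ A; b \<in> univ A; x b = l; \<alpha> (x a) \<noteq> z\<rbrakk> \<Longrightarrow>
              a \<cdot>\<^bsub>A\<^esub> b \<in> S \<longleftrightarrow> a \<in> S \<and> b \<in> S"
  shows "cut A S x \<in> homs A M"
proof (rule homsI[OF A])
  show "cut A S x \<in> univ A \<rightarrow>\<^sub>E univ M"
    using homs_in_univ[OF x] zero by (auto simp: cut_def)
  fix a b assume ab: "a \<in> univ A" "b \<in> univ A"
  show "cut A S x (a \<cdot>\<^bsub>A\<^esub> b) = (if cut A S x b = l then \<alpha> (cut A S x a) else z)"
    using S[OF ab] ab mult_in_univ[OF A ab] letter_neq_zero
    by (auto simp: cut_def homs_mult_eq[OF x])
qed

text \<open>States killed by the letter are left out: they cannot be told apart from \<open>z\<close> by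
  multiplying them with something.\<close>

definition live_states :: "'b binary_algebra \<Rightarrow> ('b \<Rightarrow> 'a) \<Rightarrow> 'b set" where
  "live_states A x = {a \<in> univ A. \<alpha> (x a) \<noteq> z}"

definition letters :: "'b binary_algebra \<Rightarrow> ('b \<Rightarrow> 'a) \<Rightarrow> 'b set" where
  "letters A x = {a \<in> univ A. x a = l}"

lemma live_states_letters_disjoint: "live_states A x \<inter> letters A x = {}"
proof (rule equals0I)
  fix a assume "a \<in> live_states A x \<inter> letters A x"
  then have "\<alpha> (x a) \<noteq> z" "x a = l" unfolding live_states_def letters_def by blast+
  then show False by simp
qed

text \<open>No product is the letter, so a hom that has lost all its states respects products
  trivially, whichever of its letters are kept.\<close>

lemma letter_part_homs:
  assumes A: "is_algebra A" and x: "x \<in> homs A M" and V: "V \<subseteq> letters A x"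
  shows "(\<lambda>a\<in>univ A. if a \<in> V then l else z) \<in> homs A M"
proof (rule homsI[OF A])
  fix a b assume ab: "a \<in> univ A" "b \<in> univ A"
  have "x (a \<cdot>\<^bsub>A\<^esub> b) \<noteq> l"
    using homs_mult_eq[OF x ab] homs_in_univ[OF x ab(1)] letter_neq_zero by auto
  then have "a \<cdot>\<^bsub>A\<^esub> b \<notin> V" using V by (auto simp: letters_def)
  then show "(\<lambda>a\<in>univ A. if a \<in> V then l else z) (a \<cdot>\<^bsub>A\<^esub> b) =
      (if (\<lambda>a\<in>univ A. if a \<in> V then l else z) b = l
       then \<alpha> ((\<lambda>a\<in>univ A. if a \<in> V then l else z) a) else z)"
    using ab mult_in_univ[OF A ab] by auto
qed (use zero letter in auto)

text \<open>Cutting \<open>x\<close> to \<open>shared A x Z\<close> keeps \<open>x\<close> where it agrees with all members of \<open>Z\<close> on what is a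
  live state and what is a letter. Unlike a meet of homs, the members of \<open>Z\<close> need not have the
  same values, and so different cyclic values can be compared with one minimal hom.\<close>

definition shared :: "'b binary_algebra \<Rightarrow> ('b \<Rightarrow> 'a) \<Rightarrow> ('b \<Rightarrow> 'a) set \<Rightarrow> 'b set" where
  "shared A x Z = (live_states A x \<inter> (\<Inter>y\<in>Z. live_states A y)) \<union> (letters A x \<inter> (\<Inter>y\<in>Z. letters A y))"

text \<open>Here periodicity enters: \<open>\<alpha>\<close> kills no nonzero element of its image, so a product
  \<open>a \<cdot> b\<close> is live under \<open>y\<close> exactly if \<open>a\<close> is live and \<open>b\<close> is a letter.\<close>

lemma cut_shared_homs:
  assumes A: "is_algebra A" and x: "x \<in> homs A M" and Z: "Z \<subseteq> homs A M"
  shows "cut A (shared A x Z) x \<in> homs A M"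
proof (rule cut_homs[OF A x])
  fix a b assume ab: "a \<in> univ A" "b \<in> univ A" "x b = l" "\<alpha> (x a) \<noteq> z"
  have xab: "x (a \<cdot>\<^bsub>A\<^esub> b) = \<alpha> (x a)" using ab homs_mult_eq[OF x] by simp
  have \<alpha>\<alpha>: "\<alpha> (\<alpha> (y a)) = z \<longleftrightarrow> \<alpha> (y a) = z" if "y \<in> homs A M" for y
    using \<alpha>_eq_zero_iff homs_in_univ[OF that ab(1)] by blast
  have st: "a \<cdot>\<^bsub>A\<^esub> b \<in> live_states A y \<longleftrightarrow> y b = l \<and> a \<in> live_states A y" if "y \<in> homs A M" for y
    using \<alpha>\<alpha>[OF that] homs_mult_eq[OF that ab(1,2)] ab(1) mult_in_univ[OF A ab(1,2)]
    by (auto simp: live_states_def)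
  have "\<alpha> (x b) = z" by (simp add: ab(3))
  moreover have "x a \<noteq> l"
  proof
    assume "x a = l"
    with ab(4) show False by simp
  qed
  moreover have "x (a \<cdot>\<^bsub>A\<^esub> b) \<noteq> l" using homs_in_univ[OF x ab(1)] by (simp add: xab)
  ultimately have "a \<in> live_states A x" "a \<notin> letters A x" "b \<in> letters A x" "b \<notin> live_states A x"
    "a \<cdot>\<^bsub>A\<^esub> b \<in> live_states A x" "a \<cdot>\<^bsub>A\<^esub> b \<notin> letters A x"
    using ab st[OF x] unfolding live_states_def letters_def by blast+
  then show "a \<cdot>\<^bsub>A\<^esub> b \<in> shared A x Z \<longleftrightarrow> a \<in> shared A x Z \<and> b \<in> shared A x Z"
  proof -
    assume *: "a \<in> live_states A x" "a \<notin> letters A x" "b \<in> letters A x" "b \<notin> live_states A x"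
      "a \<cdot>\<^bsub>A\<^esub> b \<in> live_states A x" "a \<cdot>\<^bsub>A\<^esub> b \<notin> letters A x"
    have "a \<cdot>\<^bsub>A\<^esub> b \<in> shared A x Z \<longleftrightarrow> (\<forall>y\<in>Z. a \<cdot>\<^bsub>A\<^esub> b \<in> live_states A y)"
      using * by (simp add: shared_def)
    also have "\<dots> \<longleftrightarrow> (\<forall>y\<in>Z. y b = l \<and> a \<in> live_states A y)"
      using st Z by blast
    also have "\<dots> \<longleftrightarrow> (\<forall>y\<in>Z. a \<in> live_states A y) \<and> (\<forall>y\<in>Z. b \<in> letters A y)"
      using ab(2) unfolding letters_def by blast
    also have "\<dots> \<longleftrightarrow> a \<in> shared A x Z \<and> b \<in> shared A x Z"
      using * by (simp add: shared_def)
    finally show ?thesis .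
  qed
qed


section \<open>Values outside the image of the letter\<close>

text \<open>An element that some hom sends outside the image of \<open>\<alpha>\<close> is not a product, so homs may be
  changed at it with some freedom. Let \<open>B\<close> support \<open>f\<close> at a hom \<open>x\<close> with \<open>f x = f x0\<close>. Outside
  \<open>B\<close>, make \<open>x\<close> avoid the value \<open>f x0\<close>: if the value is a state, by pushing states into the image
  of \<open>\<alpha>\<close> with \<open>core\<close>; if the value is the letter, by erasing it, after all states have been
  erased so that no product can notice. Then any element evaluating \<open>f\<close> at the new hom lies in
  \<open>B\<close>. Were none of the finitely many elements of \<open>B\<close> to evaluate \<open>f\<close> everywhere, finitely many
  homs would refute them all at once.\<close>

lemma evaluation_if_value_not_in_image:
  assumes A: "is_algebra A"
    and supp: "finitely_supported A M f"
    and fe: "finitely_evaluated A M f"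
    and x0: "x0 \<in> homs A M" "f x0 \<notin> \<alpha> ` univ M"
  shows "evaluation A M f"
proof (rule ccontr)
  assume neval: "\<not> evaluation A M f"
  have key: False if "finite B" and B: "B \<subseteq> univ A"
    and x: "x \<in> homs A M" "f x = f x0" and out: "\<And>a. a \<in> univ A \<Longrightarrow> a \<notin> B \<Longrightarrow> x a \<noteq> f x0" for B x
  proof -
    have "\<forall>b\<in>B. \<exists>y. y \<in> homs A M \<and> f y \<noteq> y b"
      using neval B unfolding evaluation_def by blast
    then obtain Y where Y: "\<And>b. b \<in> B \<Longrightarrow> Y b \<in> homs A M \<and> f (Y b) \<noteq> Y b b" by metis
    have "finite (insert x (Y ` B))" "insert x (Y ` B) \<subseteq> homs A M"
      using \<open>finite B\<close> x(1) Y by auto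
    then obtain a where a: "a \<in> univ A" "\<forall>y\<in>insert x (Y ` B). f y = y a"
      using fe unfolding finitely_evaluated_def by blast
    then have "a \<in> B" using out[of a] x(2) by auto
    then show False using a(2) Y by blast
  qed
  show False
  proof (cases "f x0 = l")
    case True
    let ?only_letters = "\<lambda>V. \<lambda>a\<in>univ A. if a \<in> V then l else z"
    let ?V = "letters A x0"
    have x: "?only_letters ?V \<in> homs A M" by (rule letter_part_homs[OF A x0(1)]) simp
    have "finite {x0, ?only_letters ?V}" "{x0, ?only_letters ?V} \<subseteq> homs A M" using x x0(1) by auto
    then obtain a where a: "a \<in> univ A" "\<forall>y\<in>{x0, ?only_letters ?V}. f y = y a"
      using fe unfolding finitely_evaluated_def by blast
    then have "x0 a = l" using True by simp
    then have "a \<in> ?V" using a(1) unfolding letters_def by blast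
    then have fx: "f (?only_letters ?V) = l" using a by simp
    obtain B where B: "finite B" "B \<subseteq> univ A"
      "\<forall>y\<in>homs A M. (\<forall>b\<in>B. y b = ?only_letters ?V b) \<longrightarrow> f y = f (?only_letters ?V)"
      by (rule finitely_supportedE[OF supp x])
    have xB: "?only_letters (?V \<inter> B) \<in> homs A M" by (rule letter_part_homs[OF A x0(1)]) simp
    show False
    proof (rule key[OF B(1,2) xB])
      show "f (?only_letters (?V \<inter> B)) = f x0" using B(3) xB fx True by auto
    qed (use True letter_neq_zero in auto)
  next
    case False
    obtain B where B: "finite B" "B \<subseteq> univ A"
      "\<forall>y\<in>homs A M. (\<forall>b\<in>B. y b = x0 b) \<longrightarrow> f y = f x0"
      by (rule finitely_supportedE[OF supp x0(1)])
    define x where "x = (\<lambda>a\<in>univ A. if a \<in> B \<or> x0 a = l then x0 a else core (x0 a))"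
    have core_l: "core u \<noteq> l" if "u \<in> univ M" for u
      using core_in_image[OF that] \<alpha>_neq_letter by (metis imageE)
    have x: "x \<in> homs A M"
    proof (rule homsI[OF A])
      show "x \<in> univ A \<rightarrow>\<^sub>E univ M"
        using homs_in_univ[OF x0(1)] core_in_image by (fastforce simp: x_def)
      fix a b assume ab: "a \<in> univ A" "b \<in> univ A"
      have "x0 (a \<cdot>\<^bsub>A\<^esub> b) \<in> \<alpha> ` univ M"
        using homs_mult_eq[OF x0(1) ab] homs_in_univ[OF x0(1) ab(1)] zero
        by (auto intro: rev_image_eqI[of z])
      then have "x (a \<cdot>\<^bsub>A\<^esub> b) = x0 (a \<cdot>\<^bsub>A\<^esub> b)"
        using mult_in_univ[OF A ab] by (simp add: x_def core_image)
      moreover have "\<alpha> (x a) = \<alpha> (x0 a)" "x b = l \<longleftrightarrow> x0 b = l"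
        using ab homs_in_univ[OF x0(1)] by (auto simp: x_def \<alpha>_core core_l)
      ultimately show "x (a \<cdot>\<^bsub>A\<^esub> b) = (if x b = l then \<alpha> (x a) else z)"
        by (simp add: homs_mult_eq[OF x0(1) ab])
    qed
    show False
    proof (rule key[OF B(1,2) x])
      have "\<forall>b\<in>B. x b = x0 b" using B(2) by (auto simp: x_def)
      then show "f x = f x0" using B(3) x by blast
      fix a assume a: "a \<in> univ A" "a \<notin> B"
      then show "x a \<noteq> f x0"
        using core_in_image[OF homs_in_univ[OF x0(1) a(1)]] x0(2) False by (auto simp: x_def)
    qed
  qed
qed


section \<open>Values inside the image of the letter\<close>

text \<open>Multiplying \<open>N\<close> times by each letter of a list applies \<open>core\<close> to a state and so does not change
  its image under \<open>\<alpha>\<close>, but it gives \<open>z\<close> under every hom that does not send the whole list to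
  \<open>l\<close>.\<close>

definition act_list :: "'b binary_algebra \<Rightarrow> 'b \<Rightarrow> 'b list \<Rightarrow> 'b" where
  "act_list A = foldl (\<lambda>a v. ((\<lambda>b. b \<cdot>\<^bsub>A\<^esub> v) ^^ N) a)"

lemma homs_act_list:
  assumes A: "is_algebra A" and x: "x \<in> homs A M"
    and "a \<in> univ A" "set vs \<subseteq> univ A" "vs \<noteq> []"
  shows "act_list A a vs \<in> univ A"
    and "x (act_list A a vs) = (if \<forall>v\<in>set vs. x v = l then core (x a) else z)"
proof -
  have pow: "((\<lambda>b. b \<cdot>\<^bsub>A\<^esub> v) ^^ n) a \<in> univ A \<and>
      x (((\<lambda>b. b \<cdot>\<^bsub>A\<^esub> v) ^^ n) a) = (if n = 0 then x a else if x v = l then (\<alpha> ^^ n) (x a) else z)"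
    if "a \<in> univ A" "v \<in> univ A" for a v n
    using that by (induction n) (auto simp: mult_in_univ[OF A] homs_mult_eq[OF x])
  define st where "st = (\<lambda>a v. ((\<lambda>b. b \<cdot>\<^bsub>A\<^esub> v) ^^ N) a)"
  have st: "st a v \<in> univ A" "x (st a v) = (if x v = l then core (x a) else z)"
    if "a \<in> univ A" "v \<in> univ A" for a v
    using pow[OF that, of N] N_pos by (auto simp: st_def core_def)
  have core2: "core (core u) = core u" if "u \<in> univ M" for u
    using core_image[OF core_in_image[OF that]] .
  have "foldl st a vs \<in> univ A \<and>
      x (foldl st a vs) = (if \<forall>v\<in>set vs. x v = l then core (x a) else z)"
    using assms(3-5)
  proof (induction vs arbitrary: a)
    case (Cons v vs)
    show ?case
    proof (cases "vs = []")
      case True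
      then show ?thesis using Cons.prems st by simp
    next
      case False
      then show ?thesis
        using Cons.IH[of "st a v"] Cons.prems st[of a v] core2[OF homs_in_univ[OF x Cons.prems(1)]]
        by auto
    qed
  qed simp
  then show "act_list A a vs \<in> univ A"
    and "x (act_list A a vs) = (if \<forall>v\<in>set vs. x v = l then core (x a) else z)"
    by (auto simp: act_list_def st_def)
qed

text \<open>Order the homs \<open>y\<close> with \<open>f y \<noteq> z\<close> by their live states and letters. There is a least
  support, that of the hom \<open>x1\<close>, because a cut of \<open>x0\<close> to the elements shared with all such \<open>y\<close> is,
  on a finite support of \<open>f\<close>, a cut to those shared with finitely many \<open>y\<close>. Write \<open>U\<close> and \<open>V\<close> for the
  live states and letters of \<open>x1\<close>. Then \<open>f y \<noteq> z\<close> if and only if \<open>y\<close> is live on \<open>U\<close> and \<open>l\<close> on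
  \<open>V\<close>, and it is enough to test this on a finite set \<open>B\<close>.

  Join \<open>u\<close> to \<open>u \<cdot> v\<close> for \<open>u\<close> in \<open>U\<close> and \<open>v\<close> in \<open>V\<close>. The resulting graph on \<open>U\<close> is connected. Otherwise
  \<open>x1\<close> cut to a component and \<open>x1\<close> cut to the rest of \<open>U\<close> are homs with smaller support, where \<open>f\<close> is
  \<open>z\<close>, and no element evaluates \<open>f\<close> at these two homs and at \<open>x1\<close>. Connectedness has two uses.
  A hom that is \<open>l\<close> on \<open>V\<close> is determined on \<open>U\<close>, up to \<open>\<alpha>\<close>, by its value at one point; this leaves finitely
  many values of \<open>f\<close> to match, and some \<open>a\<close> in \<open>U\<close> matches them all. And since \<open>B\<close> is finite, finitely many letters
  in \<open>V\<close> suffice to join \<open>a\<close> to all of \<open>B \<inter> U\<close>. Multiplying \<open>a\<close> by these and by \<open>B \<inter> V\<close> gives an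
  element that is nonzero under \<open>y\<close> exactly if \<open>f y \<noteq> z\<close>, and that then has the value \<open>f y\<close>.\<close>

lemma evaluation_if_values_in_image:
  fixes A :: "'b binary_algebra"
  assumes A: "is_algebra A"
    and supp: "finitely_supported A M f"
    and fe: "finitely_evaluated A M f"
    and im: "\<And>x. x \<in> homs A M \<Longrightarrow> f x \<in> \<alpha> ` univ M"
    and x0: "x0 \<in> homs A M" "f x0 \<noteq> z"
  shows "evaluation A M f"
proof -
  have ev: "\<exists>a\<in>univ A. \<forall>x\<in>X. f x = x a" if "finite X" "X \<subseteq> homs A M" for X
    using fe that unfolding finitely_evaluated_def by blast
  define Y where "Y = {y \<in> homs A M. f y \<noteq> z}"
  have fl: "f x \<noteq> l" if "x \<in> homs A M" for x
    using im[OF that] \<alpha>_neq_letter by (metis imageE)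
  \<comment> \<open>A nonzero value in the image of \<open>\<alpha>\<close> is not killed by \<open>\<alpha>\<close>.\<close>
  have live: "a \<in> live_states A y" if "y \<in> homs A M" "f y \<noteq> z" "f y = y a" "a \<in> univ A" for y a
    using that im[of y] \<alpha>_eq_zero_iff[of "f y"] by (simp add: live_states_def)

  define x1 where "x1 = cut A (shared A x0 Y) x0"
  have x1: "x1 \<in> homs A M"
    unfolding x1_def by (rule cut_shared_homs[OF A x0(1)]) (auto simp: Y_def)
  define U where "U = live_states A x1"
  define V where "V = letters A x1"
  obtain B where B: "finite B" "B \<subseteq> univ A"
    "\<forall>y\<in>homs A M. (\<forall>b\<in>B. y b = x1 b) \<longrightarrow> f y = f x1"
    by (rule finitely_supportedE[OF supp x1])
  have f_B: "f y = f x1" if "y \<in> homs A M" "\<And>b. b \<in> B \<Longrightarrow> y b = x1 b" for y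
    using that B(3) by blast

  have fx1: "f x1 \<noteq> z"
  proof -
    have "x0 \<in> Y" using x0 by (simp add: Y_def)
    then have shared_iff: "b \<in> shared A x0 Z \<longleftrightarrow> (\<forall>y\<in>Z. b \<in> shared A x0 {y})" if "x0 \<in> Z" for b Z
      using that live_states_letters_disjoint[of A x0] unfolding shared_def
      by (cases "b \<in> live_states A x0") auto
    have "\<forall>b\<in>B - shared A x0 Y. \<exists>y. y \<in> Y \<and> b \<notin> shared A x0 {y}"
      using shared_iff[OF \<open>x0 \<in> Y\<close>] by blast
    then obtain y where y: "\<And>b. b \<in> B - shared A x0 Y \<Longrightarrow> y b \<in> Y \<and> b \<notin> shared A x0 {y b}" by metis
    define Z where "Z = insert x0 (y ` (B - shared A x0 Y))"
    have Z: "finite Z" "Z \<subseteq> Y" "Z \<subseteq> homs A M" using B(1) y x0 by (auto simp: Z_def Y_def)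
    define x where "x = cut A (shared A x0 Z) x0"
    have x: "x \<in> homs A M" unfolding x_def by (rule cut_shared_homs[OF A x0(1) Z(3)])
    have "b \<in> shared A x0 Z \<longleftrightarrow> b \<in> shared A x0 Y" if "b \<in> B" for b
    proof
      show "b \<in> shared A x0 Z" if "b \<in> shared A x0 Y" using that Z(2) by (auto simp: shared_def)
      show "b \<in> shared A x0 Y" if "b \<in> shared A x0 Z"
      proof (rule ccontr)
        assume "b \<notin> shared A x0 Y"
        then have "y b \<in> Z" "b \<notin> shared A x0 {y b}" using y[of b] \<open>b \<in> B\<close> by (auto simp: Z_def)
        then show False using that by (auto simp: shared_def)
      qed
    qed
    then have "f x = f x1" using B(2) by (intro f_B[OF x]) (auto simp: x_def x1_def cut_def)
    obtain a where a: "a \<in> univ A" "\<forall>y\<in>insert x Z. f y = y a"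
      using ev[of "insert x Z"] Z x by auto
    have "a \<in> live_states A y" if "y \<in> Z" for y
      using live[of y a] a that Z(2) by (auto simp: Y_def)
    then have "a \<in> shared A x0 Z" by (auto simp: shared_def Z_def)
    then have "f x = f x0" using a by (simp add: x_def cut_def Z_def)
    then show ?thesis using \<open>f x = f x1\<close> x0 by simp
  qed
  have above: "U \<subseteq> live_states A y \<and> V \<subseteq> letters A y" if "y \<in> homs A M" "f y \<noteq> z" for y
    using that letter_neq_zero live_states_letters_disjoint[of A x0]
    by (auto simp: U_def V_def live_states_def letters_def x1_def cut_def shared_def Y_def split: if_splits)
  have nonzero_if: "f y \<noteq> z" if y: "y \<in> homs A M" and "B \<inter> U \<subseteq> live_states A y" "B \<inter> V \<subseteq> letters A y" for y
  proof -
    let ?x = "cut A (shared A x1 {y}) x1"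
    have x: "?x \<in> homs A M" using cut_shared_homs[OF A x1] y by simp
    have x1_z: "x1 b = z" if "b \<in> univ A" "b \<notin> U" "b \<notin> V" for b
      using that by (auto simp: U_def V_def live_states_def letters_def x1_def cut_def shared_def)
    have "f ?x = f x1"
      using that(2,3) B(2) x1_z by (intro f_B[OF x]) (auto simp: cut_def shared_def U_def V_def)
    obtain a where a: "a \<in> univ A" "f ?x = ?x a" "f y = y a"
      using ev[of "{?x, y}"] x y by auto
    have "a \<in> shared A x1 {y}" using a(1,2) \<open>f ?x = f x1\<close> fx1 by (auto simp: cut_def split: if_splits)
    then have "a \<in> live_states A y \<union> letters A y" by (auto simp: shared_def)
    moreover have "a \<notin> live_states A y \<union> letters A y" if "y a = z"
      using that letter_neq_zero by (simp add: live_states_def letters_def)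
    ultimately show ?thesis using a(3) by metis
  qed

  \<comment> \<open>Without letters in \<open>V\<close>, turning all of \<open>U\<close> into letters would be a hom on which \<open>f\<close> has the
    value \<open>l\<close>, which is not in the image of \<open>\<alpha>\<close>.\<close>
  obtain v0 where v0: "v0 \<in> V"
  proof (rule ccontr)
    assume "\<not> thesis"
    with that have V: "V = {}" by blast
    define x' where "x' = (\<lambda>a\<in>univ A. if x1 a \<noteq> z then l else z)"
    have "x' \<in> homs A M"
    proof (rule homsI[OF A])
      fix a b assume ab: "a \<in> univ A" "b \<in> univ A"
      have "x1 (a \<cdot>\<^bsub>A\<^esub> b) = z" using homs_mult_eq[OF x1 ab] V ab by (auto simp: V_def letters_def)
      then show "x' (a \<cdot>\<^bsub>A\<^esub> b) = (if x' b = l then \<alpha> (x' a) else z)"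
        using mult_in_univ[OF A ab] ab by (auto simp: x'_def)
    qed (use letter zero in \<open>auto simp: x'_def\<close>)
    moreover from this obtain a where "a \<in> univ A" "f x1 = x1 a" "f x' = x' a"
      using ev[of "{x1, x'}"] x1 by auto
    then have "f x' = l" using fx1 by (simp add: x'_def)
    ultimately show False using fl by blast
  qed

  obtain a0 where a0: "a0 \<in> univ A" "f x1 = x1 a0" using ev[of "{x1}"] x1 by auto
  have a0U: "a0 \<in> U" using live[OF x1 fx1 a0(2,1)] by (simp add: U_def)
  \<comment> \<open>A version of connectedness without paths: \<open>u\<close> is linked to \<open>a0\<close> if finitely many letters
    force the values at \<open>u\<close> and at \<open>a0\<close> to determine each other up to \<open>\<alpha>\<close>. This is
    inherited along edges in both directions since \<open>\<alpha>\<close> is injective on its image.\<close>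
  define tied where "tied = (\<lambda>u W. \<forall>y\<in>homs A M. \<forall>y'\<in>homs A M. (\<forall>w\<in>W. y w = l \<and> y' w = l) \<longrightarrow>
      (\<alpha> (y a0) = \<alpha> (y' a0) \<longleftrightarrow> \<alpha> (y u) = \<alpha> (y' u)))"
  define linked where "linked = (\<lambda>u. \<exists>W. finite W \<and> W \<subseteq> V \<and> tied u W)"
  have linked_step: "linked (u \<cdot>\<^bsub>A\<^esub> v) \<longleftrightarrow> linked u" if u: "u \<in> univ A" and v: "v \<in> V" for u v
  proof -
    have vA: "v \<in> univ A" using v by (simp add: V_def letters_def)
    have eq: "\<alpha> (y (u \<cdot>\<^bsub>A\<^esub> v)) = \<alpha> (y' (u \<cdot>\<^bsub>A\<^esub> v)) \<longleftrightarrow> \<alpha> (y u) = \<alpha> (y' u)"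
      if "y \<in> homs A M" "y' \<in> homs A M" "y v = l" "y' v = l" for y y'
      using that u vA \<alpha>_inj_on_image[of "\<alpha> (y u)" "\<alpha> (y' u)"]
      by (auto simp: homs_mult_eq homs_in_univ)
    have "tied (u \<cdot>\<^bsub>A\<^esub> v) (insert v W) \<longleftrightarrow> tied u (insert v W)" for W
      unfolding tied_def using eq by (auto 0 4)
    moreover have "tied w (insert v W)" if "tied w W" for w W
      using that unfolding tied_def by blast
    ultimately show ?thesis
      unfolding linked_def using v by (metis finite_insert insert_subset)
  qed
  have "linked a0" unfolding linked_def tied_def by (intro exI[of _ "{}"]) simp

  have cut_component: "cut A (K \<union> V) x1 \<in> homs A M"
    if "K \<subseteq> U" and K: "\<And>u v. \<lbrakk>u \<in> U; v \<in> V\<rbrakk> \<Longrightarrow> u \<cdot>\<^bsub>A\<^esub> v \<in> K \<longleftrightarrow> u \<in> K" for K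
  proof (rule cut_homs[OF A x1])
    fix a b assume ab: "a \<in> univ A" "b \<in> univ A" "x1 b = l" "\<alpha> (x1 a) \<noteq> z"
    then have "a \<in> U" "b \<in> V" by (auto simp: U_def V_def live_states_def letters_def)
    moreover have "x1 (a \<cdot>\<^bsub>A\<^esub> b) \<noteq> l"
      using ab homs_in_univ[OF x1 ab(1)] by (simp add: homs_mult_eq[OF x1])
    then have "a \<cdot>\<^bsub>A\<^esub> b \<notin> V" by (simp add: V_def letters_def)
    moreover have "a \<notin> V" using \<open>a \<in> U\<close> live_states_letters_disjoint[of A x1] by (auto simp: U_def V_def)
    ultimately show "a \<cdot>\<^bsub>A\<^esub> b \<in> K \<union> V \<longleftrightarrow> a \<in> K \<union> V \<and> b \<in> K \<union> V" using K by auto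
  qed
  have U_step: "u \<cdot>\<^bsub>A\<^esub> v \<in> U" if "u \<in> U" "v \<in> V" for u v
  proof -
    have uv: "u \<in> univ A" "v \<in> univ A" "x1 v = l" "\<alpha> (x1 u) \<noteq> z"
      using that by (auto simp: U_def V_def live_states_def letters_def)
    then show ?thesis
      using \<alpha>_eq_zero_iff[of "\<alpha> (x1 u)"] homs_in_univ[OF x1 uv(1)] mult_in_univ[OF A uv(1,2)]
      by (simp add: U_def live_states_def homs_mult_eq[OF x1])
  qed
  have U_univ: "U \<subseteq> univ A" by (auto simp: U_def live_states_def)
  have linked_U: "linked u" if u: "u \<in> U" for u
  proof (rule ccontr)
    assume "\<not> linked u"
    define K where "K = {w \<in> U. linked w}"
    have step: "w \<cdot>\<^bsub>A\<^esub> v \<in> K \<longleftrightarrow> w \<in> K" "w \<cdot>\<^bsub>A\<^esub> v \<in> U - K \<longleftrightarrow> w \<in> U - K" if "w \<in> U" "v \<in> V" for w v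
      using that linked_step[of w v] U_step[of w v] U_univ by (auto simp: K_def)
    have proper: "f (cut A (K' \<union> V) x1) = z \<and> cut A (K' \<union> V) x1 \<in> homs A M"
      if "K' \<subseteq> U" "w \<in> U - K'" "\<And>u v. \<lbrakk>u \<in> U; v \<in> V\<rbrakk> \<Longrightarrow> u \<cdot>\<^bsub>A\<^esub> v \<in> K' \<longleftrightarrow> u \<in> K'" for K' w
    proof -
      have h: "cut A (K' \<union> V) x1 \<in> homs A M" by (rule cut_component) fact+
      have "w \<notin> V" using that(2) live_states_letters_disjoint[of A x1] by (auto simp: U_def V_def)
      then have "w \<notin> live_states A (cut A (K' \<union> V) x1)" using that(2) by (auto simp: live_states_def cut_def)
      then show ?thesis using above[OF h] h that(2) by blast
    qed
    have 1: "f (cut A (K \<union> V) x1) = z \<and> cut A (K \<union> V) x1 \<in> homs A M"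
      using proper[of K u] step \<open>\<not> linked u\<close> u by (auto simp: K_def)
    have 2: "f (cut A ((U - K) \<union> V) x1) = z \<and> cut A ((U - K) \<union> V) x1 \<in> homs A M"
      using proper[of "U - K" a0] step \<open>linked a0\<close> a0U by (auto simp: K_def)
    obtain a where a: "a \<in> univ A" "f x1 = x1 a" "cut A (K \<union> V) x1 a = z" "cut A ((U - K) \<union> V) x1 a = z"
      using ev[of "{x1, cut A (K \<union> V) x1, cut A ((U - K) \<union> V) x1}"] x1 1 2 by auto
    have "a \<in> U" using live[OF x1 fx1 a(2,1)] by (simp add: U_def)
    then show False using a fx1 by (auto simp: cut_def split: if_splits)
  qed

  have same_value: "f y = f y'"
    if y: "y \<in> Y" "y' \<in> Y" and eq: "\<alpha> (y a0) = \<alpha> (y' a0)" for y y'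
  proof -
    have h: "y \<in> homs A M" "y' \<in> homs A M" using y by (auto simp: Y_def)
    obtain a where a: "a \<in> univ A" "f x1 = x1 a" "f y = y a" "f y' = y' a"
      using ev[of "{x1, y, y'}"] x1 h by auto
    have "linked a" using live[OF x1 fx1 a(2,1)] linked_U by (simp add: U_def)
    moreover have "\<forall>w\<in>V. y w = l \<and> y' w = l"
      using above[of y] above[of y'] y by (auto simp: Y_def letters_def)
    ultimately have "\<alpha> (y a) = \<alpha> (y' a)"
      using h eq unfolding linked_def tied_def by blast
    then show ?thesis using \<alpha>_inj_on_image im[OF h(1)] im[OF h(2)] a by metis
  qed

  \<comment> \<open>Members of \<open>Y\<close> that agree at \<open>a0\<close> up to \<open>\<alpha>\<close> have the same value under \<open>f\<close>, so one representative for
    each element of \<open>M\<close> suffices to find \<open>a\<close>.\<close>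
  define pick where "pick = (\<lambda>c. SOME y'. y' \<in> Y \<and> \<alpha> (y' a0) = c)"
  define rep where "rep = (\<lambda>y. pick (\<alpha> (y a0)))"
  have rep: "rep y \<in> Y" "\<alpha> (rep y a0) = \<alpha> (y a0)" if "y \<in> Y" for y
    using someI[of "\<lambda>y'. y' \<in> Y \<and> \<alpha> (y' a0) = \<alpha> (y a0)" y] that
    unfolding rep_def pick_def by blast+
  have "\<alpha> (y a0) \<in> univ M" if "y \<in> Y" for y
    using that homs_in_univ[of y A M a0] a0(1) by (simp add: Y_def)
  then have "rep ` Y \<subseteq> pick ` univ M" by (auto simp: rep_def)
  then have "finite (rep ` Y)" using finite_univ finite_surj by blast
  then obtain a where a: "a \<in> univ A" "f x1 = x1 a" "\<And>y. y \<in> Y \<Longrightarrow> f (rep y) = rep y a"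
    using ev[of "insert x1 (rep ` Y)"] rep(1) x1 by (auto simp: Y_def)
  have aU: "a \<in> U" using live[OF x1 fx1 a(2,1)] by (simp add: U_def)
  have f_Y: "f y = core (y a)" if y: "y \<in> Y" for y
  proof -
    have h: "y \<in> homs A M" "rep y \<in> homs A M" using y rep(1) by (auto simp: Y_def)
    have "\<forall>w\<in>V. y w = l \<and> rep y w = l"
      using above[of y] above[of "rep y"] y rep(1) by (auto simp: Y_def letters_def)
    then have "\<alpha> (y a) = \<alpha> (rep y a)"
      using linked_U[OF aU] h rep(2)[OF y] unfolding linked_def tied_def by (metis subsetD)
    then have "core (y a) = core (rep y a)" by (rule core_eq_if_\<alpha>_eq)
    also have "\<dots> = rep y a" using a(3)[OF y] im[OF h(2)] core_image by simp
    also have "\<dots> = f y" using a(3)[OF y] same_value[OF y rep(1)[OF y]] rep(2)[OF y] by simp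
    finally show ?thesis by simp
  qed

  obtain W where W: "\<And>u. u \<in> U \<Longrightarrow> finite (W u) \<and> W u \<subseteq> V \<and> tied u (W u)"
    using linked_U unfolding linked_def by metis
  define F where "F = insert v0 (B \<inter> V) \<union> W a \<union> (\<Union>u\<in>B \<inter> U. W u)"
  have F: "finite F" "F \<subseteq> V"
    using B(1) W aU v0 by (auto simp: F_def)
  obtain vs where vs: "set vs = F" using F(1) finite_list by blast
  have V_univ: "V \<subseteq> univ A" by (auto simp: V_def letters_def)
  have vs_props: "set vs \<subseteq> univ A" "vs \<noteq> []" using vs F(2) V_univ by (auto simp: F_def)
  have "f y = y (act_list A a vs)" if y: "y \<in> homs A M" for y
  proof (cases "f y = z")
    case False
    then have "\<forall>v\<in>set vs. y v = l" using above[OF y] F(2) vs by (auto simp: letters_def)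
    then have "y (act_list A a vs) = core (y a)" using homs_act_list(2)[OF A y a(1) vs_props] by metis
    moreover have "f y = core (y a)" using False y by (intro f_Y) (simp add: Y_def)
    ultimately show ?thesis by metis
  next
    case True
    have "y (act_list A a vs) = z"
    proof (rule ccontr)
      assume nz: "y (act_list A a vs) \<noteq> z"
      then have yF: "\<forall>v\<in>F. y v = l" and "core (y a) \<noteq> z"
        using homs_act_list(2)[OF A y a(1) vs_props] vs by metis+
      then have ya: "\<alpha> (y a) \<noteq> z"
        using core_eq_if_\<alpha>_eq[of "y a" z] \<alpha>_zero core_zero by metis
      \<comment> \<open>A hom that is \<open>z\<close> on \<open>U\<close>: comparing \<open>y\<close> with it turns being tied into being equally
        live.\<close>
      define y' where "y' = (\<lambda>c\<in>univ A. if c \<in> V then l else z)"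
      have y': "y' \<in> homs A M"
        unfolding y'_def by (rule letter_part_homs[OF A x1]) (simp add: V_def)
      have y'U: "y' u = z" if "u \<in> U" for u
        using that live_states_letters_disjoint[of A x1] U_univ by (auto simp: y'_def U_def V_def)
      have link: "\<alpha> (y a0) = z \<longleftrightarrow> \<alpha> (y u) = z" if "u \<in> U" "W u \<subseteq> F" for u
      proof -
        have "\<forall>w\<in>W u. y w = l \<and> y' w = l"
          using that(2) yF F(2) V_univ by (auto simp: y'_def)
        then have "\<alpha> (y a0) = \<alpha> (y' a0) \<longleftrightarrow> \<alpha> (y u) = \<alpha> (y' u)"
          using W[OF that(1)] y y' unfolding tied_def by blast
        then show ?thesis using y'U a0U that(1) by simp
      qed
      have "\<alpha> (y a0) \<noteq> z" using link[OF aU] ya by (auto simp: F_def)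
      then have "B \<inter> U \<subseteq> live_states A y" using link U_univ by (force simp: F_def live_states_def)
      moreover have "B \<inter> V \<subseteq> letters A y" using yF V_univ by (auto simp: F_def letters_def)
      ultimately show False using nonzero_if[OF y] True by blast
    qed
    then show ?thesis using True by simp
  qed
  then show ?thesis
    unfolding evaluation_def using homs_act_list(1)[OF A x1 a(1) vs_props] by blast
qed

lemma dualizable_if_whiskery: "dualizable TYPE('i) TYPE('b) M"
  unfolding dualizable_def
proof (intro ballI allI impI)
  fix A :: "'b binary_algebra" and f
  assume "A \<in> ISP TYPE('i) M"
  then have A: "is_algebra A" by (simp add: ISP_def)
  assume f: "continuous_map (hom_topology A M) (discrete_topology (univ M)) f \<and>
     (\<forall>k R. compatible_relation M k R \<longrightarrow> preserves A M f k R)"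
  then have fe: "finitely_evaluated A M f"
    using preserves_all_iff_finitely_evaluated[OF A] by blast
  have supp: "finitely_supported A M f"
    using f unfolding continuous_iff_finitely_supported by blast
  consider x0 where "x0 \<in> homs A M" "f x0 \<notin> \<alpha> ` univ M"
    | x0 where "\<forall>x\<in>homs A M. f x \<in> \<alpha> ` univ M" "x0 \<in> homs A M" "f x0 \<noteq> z"
    | "\<forall>x\<in>homs A M. f x = z"
    by blast
  then show "evaluation A M f"
  proof cases
    case 1
    then show ?thesis using evaluation_if_value_not_in_image[OF A supp fe] by blast
  next
    case 2
    then show ?thesis using evaluation_if_values_in_image[OF A supp fe] by blast
  next
    case 3
    obtain a where a: "a \<in> univ A" using A by (auto simp: is_algebra_def)
    have "x (a \<cdot>\<^bsub>A\<^esub> a) = z" if "x \<in> homs A M" for x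
      using homs_mult_eq[OF that a a] by simp
    then show ?thesis using 3 mult_in_univ[OF A a a] unfolding evaluation_def by metis
  qed
qed

end


section \<open>Dualizability\<close>

context one_letter_algebra
begin

text \<open>The product of the periods is a common period.\<close>

lemma common_period:
  assumes "\<forall>u\<in>univ M. \<exists>n\<ge>1. (\<alpha> ^^ n) (\<alpha> u) = \<alpha> u"
  shows "\<exists>N\<ge>1. \<forall>u\<in>univ M. (\<alpha> ^^ N) (\<alpha> u) = \<alpha> u"
proof -
  obtain n where n: "\<And>u. u \<in> univ M \<Longrightarrow> n u \<ge> 1 \<and> (\<alpha> ^^ n u) (\<alpha> u) = \<alpha> u"
    using assms by metis
  have "(\<alpha> ^^ (\<Prod>u\<in>univ M. n u)) (\<alpha> u) = \<alpha> u" if u: "u \<in> univ M" for u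
  proof -
    obtain k where k: "(\<Prod>u\<in>univ M. n u) = n u * k"
      using dvd_prodI[OF finite_univ u, of n] by (elim dvdE)
    have "((\<alpha> ^^ n u) ^^ k) (\<alpha> u) = \<alpha> u" using n[OF u] by (induction k) auto
    then show ?thesis by (simp add: k funpow_mult)
  qed
  moreover have "(\<Prod>u\<in>univ M. n u) \<ge> 1" using n by (intro prod_ge_1) blast
  ultimately show ?thesis by blast
qed

text \<open>Both sides say that \<open>\<alpha>\<close> permutes its image, which is finite.\<close>

lemma periodic_iff_cancellative:
  "(\<forall>u\<in>univ M. \<exists>n\<ge>1. (\<alpha> ^^ n) (\<alpha> u) = \<alpha> u) \<longleftrightarrow>
     (\<forall>v\<in>univ M. \<forall>w\<in>univ M. \<alpha> (\<alpha> v) = \<alpha> (\<alpha> w) \<longrightarrow> \<alpha> v = \<alpha> w)"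
    (is "?periodic \<longleftrightarrow> ?cancellative")
proof
  assume ?periodic
  then obtain N where N: "N \<ge> 1" "\<And>u. u \<in> univ M \<Longrightarrow> (\<alpha> ^^ N) (\<alpha> u) = \<alpha> u"
    using common_period by blast
  obtain n where "N = Suc n" using N(1) by (cases N) auto
  then have "\<alpha> u = (\<alpha> ^^ n) (\<alpha> (\<alpha> u))" if "u \<in> univ M" for u
    using N(2)[OF that] by (simp add: funpow_swap1)
  then show ?cancellative by metis
next
  assume canc: ?cancellative
  have cancel: "\<lbrakk>v \<in> univ M; w \<in> univ M; (\<alpha> ^^ i) (\<alpha> v) = (\<alpha> ^^ i) (\<alpha> w)\<rbrakk> \<Longrightarrow> \<alpha> v = \<alpha> w"
    for i v w
  proof (induction i arbitrary: v w)
    case (Suc i)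
    then have "\<alpha> (\<alpha> v) = \<alpha> (\<alpha> w)"
      by (intro Suc.IH) (simp_all add: funpow_swap1)
    then show ?case using canc Suc.prems by blast
  qed simp
  show ?periodic
  proof
    fix u assume u: "u \<in> univ M"
    have "range (\<lambda>i. (\<alpha> ^^ i) (\<alpha> u)) \<subseteq> univ M" using u funpow_\<alpha>_in_univ by auto
    then have "\<not> inj (\<lambda>i. (\<alpha> ^^ i) (\<alpha> u))"
      using finite_univ finite_imageD finite_subset infinite_UNIV_nat by blast
    then obtain i j where "i < j" and eq: "(\<alpha> ^^ i) (\<alpha> u) = (\<alpha> ^^ j) (\<alpha> u)"
      unfolding inj_def by (metis linorder_neqE_nat)
    then have "(\<alpha> ^^ i) (\<alpha> ((\<alpha> ^^ (j - i)) u)) = (\<alpha> ^^ i) (\<alpha> u)"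
      using funpow_add[of i "j - i" \<alpha>] by (simp add: funpow_swap1)
    then have "\<alpha> ((\<alpha> ^^ (j - i)) u) = \<alpha> u"
      by (intro cancel[of _ _ i]) (use u funpow_\<alpha>_in_univ in auto)
    then show "\<exists>n\<ge>1. (\<alpha> ^^ n) (\<alpha> u) = \<alpha> u"
      using \<open>i < j\<close> by (intro exI[of _ "j - i"]) (simp add: funpow_swap1)
  qed
qed

theorem dualizable_iff_periodic:
  assumes "infinite (UNIV :: 'i set)" and "infinite (UNIV :: 'b set)"
  shows "dualizable TYPE('i) TYPE('b) M \<longleftrightarrow> (\<forall>u\<in>univ M. \<exists>n\<ge>1. (\<alpha> ^^ n) (\<alpha> u) = \<alpha> u)"
proof
  show "\<forall>u\<in>univ M. \<exists>n\<ge>1. (\<alpha> ^^ n) (\<alpha> u) = \<alpha> u" if "dualizable TYPE('i) TYPE('b) M"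
    using nondualizable_if_not_periodic[OF assms] that by blast
  assume "\<forall>u\<in>univ M. \<exists>n\<ge>1. (\<alpha> ^^ n) (\<alpha> u) = \<alpha> u"
  then obtain N where "N \<ge> 1" "\<And>u. u \<in> univ M \<Longrightarrow> (\<alpha> ^^ N) (\<alpha> u) = \<alpha> u"
    using common_period by blast
  then interpret whiskery_one_letter_algebra M l z N by unfold_locales
  show "dualizable TYPE('i) TYPE('b) M" by (rule dualizable_if_whiskery)
qed

end

lemma one_letter_algebra_automatic:
  assumes "automatic_algebra M Q {l} z act" and "finite (univ M)"
  shows "one_letter_algebra M l z"
proof -
  have univ: "univ M = Q \<union> {l} \<union> {z}" "l \<notin> Q" "z \<notin> Q" "l \<noteq> z"
    and rng: "ran (act l) \<subseteq> Q" "dom (act l) \<subseteq> Q"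
    and defd: "\<And>q r. \<lbrakk>q \<in> Q; r \<in> Q\<rbrakk> \<Longrightarrow> q \<cdot>\<^bsub>M\<^esub> l = r \<longleftrightarrow> act l q = Some r"
    and undef: "\<And>u v. \<lbrakk>u \<in> univ M; v \<in> univ M; \<not> (u \<in> Q \<and> v \<in> {l} \<and> u \<in> dom (act v))\<rbrakk> \<Longrightarrow> u \<cdot>\<^bsub>M\<^esub> v = z"
    using assms(1) unfolding automatic_algebra_def by auto
  show ?thesis
  proof
    fix u assume u: "u \<in> univ M"
    show "u \<cdot>\<^bsub>M\<^esub> l \<in> univ M - {l}"
    proof (cases "u \<in> dom (act l)")
      case True
      then obtain r where r: "act l u = Some r" by blast
      then have "r \<in> Q" "u \<in> Q" using rng by (auto intro: ranI)
      then show ?thesis using defd[of u r] r univ by auto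
    next
      case False
      then show ?thesis using undef[of u l] u univ by auto
    qed
  qed (use assms(2) univ undef in auto)
qed

theorem theorem6p2:
  fixes M :: "'a binary_algebra" and Q \<Sigma> :: "'a set" and z :: 'a and act :: "'a \<Rightarrow> 'a \<rightharpoonup> 'a"
  assumes "automatic_algebra M Q \<Sigma> z act"
    and "finite (univ M)"
    and "card \<Sigma> = 1"
    and "infinite (UNIV :: 'i set)" and "infinite (UNIV :: 'b set)"
  shows "(dualizable TYPE('i) TYPE('b) M \<longleftrightarrow> (\<forall>a\<in>\<Sigma>. whiskery_cycles M Q a)) \<and>
    ((\<forall>a\<in>\<Sigma>. whiskery_cycles M Q a) \<longleftrightarrow>
      (\<forall>v\<in>univ M. \<forall>w\<in>univ M. \<forall>x\<in>univ M.
         v \<cdot>\<^bsub>M\<^esub> x \<cdot>\<^bsub>M\<^esub> x = w \<cdot>\<^bsub>M\<^esub> x \<cdot>\<^bsub>M\<^esub> x \<longrightarrow> v \<cdot>\<^bsub>M\<^esub> x = w \<cdot>\<^bsub>M\<^esub> x))"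
proof -
  obtain l where \<Sigma>: "\<Sigma> = {l}" using assms(3) card_1_singletonE by blast
  interpret one_letter_algebra M l z
    by (rule one_letter_algebra_automatic[OF assms(1)[unfolded \<Sigma>] assms(2)])
  have univ: "univ M = Q \<union> {l} \<union> {z}" using assms(1) by (simp add: \<Sigma> automatic_algebra_def)
  have "(\<lambda>w. w \<cdot>\<^bsub>M\<^esub> l) = \<alpha>" by (simp add: fun_eq_iff \<alpha>_def)
  then have "left_power M q l (n + 1) = (\<alpha> ^^ n) (\<alpha> q)" for q n
    unfolding left_power_def by (simp add: funpow_swap1)
  then have "q \<cdot>\<^bsub>M\<^esub> l = left_power M q l (n + 1) \<longleftrightarrow> (\<alpha> ^^ n) (\<alpha> q) = \<alpha> q" for q n
    using \<alpha>_def[of q] by auto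
  then have "whiskery_cycles M Q l \<longleftrightarrow> (\<forall>q\<in>Q. \<exists>n\<ge>1. (\<alpha> ^^ n) (\<alpha> q) = \<alpha> q)"
    unfolding whiskery_cycles_def by simp
  also have "\<dots> \<longleftrightarrow> (\<forall>u\<in>univ M. \<exists>n\<ge>1. (\<alpha> ^^ n) (\<alpha> u) = \<alpha> u)"
  proof -
    have "(\<alpha> ^^ 1) (\<alpha> u) = \<alpha> u" if "u = l \<or> u = z" for u using that by auto
    then have "\<exists>n\<ge>1. (\<alpha> ^^ n) (\<alpha> u) = \<alpha> u" if "u = l \<or> u = z" for u using that by blast
    then show ?thesis unfolding univ by blast
  qed
  finally have whiskery: "(\<forall>a\<in>\<Sigma>. whiskery_cycles M Q a) \<longleftrightarrow>
      (\<forall>u\<in>univ M. \<exists>n\<ge>1. (\<alpha> ^^ n) (\<alpha> u) = \<alpha> u)"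
    by (simp add: \<Sigma>)
  have "(\<forall>v\<in>univ M. \<forall>w\<in>univ M. \<forall>x\<in>univ M.
         v \<cdot>\<^bsub>M\<^esub> x \<cdot>\<^bsub>M\<^esub> x = w \<cdot>\<^bsub>M\<^esub> x \<cdot>\<^bsub>M\<^esub> x \<longrightarrow> v \<cdot>\<^bsub>M\<^esub> x = w \<cdot>\<^bsub>M\<^esub> x) \<longleftrightarrow>
      (\<forall>v\<in>univ M. \<forall>w\<in>univ M. \<alpha> (\<alpha> v) = \<alpha> (\<alpha> w) \<longrightarrow> \<alpha> v = \<alpha> w)"
    using letter mult_nonletter unfolding \<alpha>_def by metis
  then show ?thesis
    using whiskery dualizable_iff_periodic[OF assms(4,5)] periodic_iff_cancellative by simp
qed

end
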